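(* Let $d\ge1$, let $N\cong\mathbb{Z}^d$ be a lattice with basis $e_1,\ldots,e_d$, and let $P\subset N_{\mathbb{Q}}$ be a $d$-dimensional canonical lattice simplex. (i) If $d\le 3$, then $\operatorname{mult}P\le (d+1)^{d-1}$, with equality if and only if $$P\cong\operatorname{conv}\{0,(d+1)e_1,\ldots,(d+1)e_d\}-(1,\ldots,1).$$ (ii) If $d=4$, then $\operatorname{mult}P\le 128$, with equality if and only if $$P\cong\operatorname{conv}\{0,2e_1,8e_2,8e_3,8e_4\}-(1,1,1,1).$$
   Context: $N_{\mathbb{Q}}:=N\otimes_{\mathbb{Z}}\mathbb{Q}$. A $d$-dimensional canonical lattice simplex is a $d$-dimensional simplex $P\subset N_{\mathbb{Q}}$ with vertices in $N$ such that the origin is the only point of $N$ in the interior of $P$. The multiplicity $\operatorname{mult}P$ is the index $[N:N']$, where $N'$ is the sublattice of $N$ generated by the vertices $v_0,\ldots,v_d$ of $P$. Here $\cong$ denotes unimodular equivalence: $Q\cong Q'$ if $Q'=AQ+w$ for some $A\in\mathrm{GL}(N)$ and $w\in N$. (For canonical lattice simplices the translation vector $w$ is necessarily $0$, because the origin is the unique interior lattice point.) *)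

theory Defs
  imports "HOL-Analysis.Analysis" "HOL-Algebra.Generated_Groups"
begin

text \<open>The ambient space is the real vector space spanned by \<open>N\<close>, modelled by \<open>real ^ 'n\<close>, instead
  of its rational form: lattice polytopes in the two spaces correspond bijectively, with the same
  vertices, lattice points and interior lattice points.\<close>

text \<open>\<open>N\<close> is the lattice with basis \<open>e 1, \<dots>, e d\<close>, where \<open>d = CARD('n)\<close>; injectivity is needed
  because independence is a property of the set of basis vectors, not of the family.\<close>

definition is_lattice_basis :: "(nat \<Rightarrow> real ^ 'n) \<Rightarrow> (real ^ 'n) set \<Rightarrow> bool" where
  "is_lattice_basis e N \<longleftrightarrow>
     inj_on e {1..CARD('n)} \<and> independent (e ` {1..CARD('n)}) \<and>
     N = range (\<lambda>c :: nat \<Rightarrow> int. \<Sum>i=1..CARD('n). of_int (c i) *\<^sub>R e i)"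

definition vertices :: "(real ^ 'n) set \<Rightarrow> (real ^ 'n) set" where
  "vertices P = {v. v extreme_point_of P}"

definition canonical_lattice_simplex :: "(real ^ 'n) set \<Rightarrow> (real ^ 'n) set \<Rightarrow> bool" where
  "canonical_lattice_simplex N P \<longleftrightarrow>
     int CARD('n) simplex P \<and> vertices P \<subseteq> N \<and> interior P \<inter> N = {0}"

definition lattice_group :: "(real ^ 'n) set \<Rightarrow> (real ^ 'n) monoid" where
  "lattice_group N = \<lparr>carrier = N, monoid.mult = (+), one = 0\<rparr>"

text \<open>The index of the sublattice generated by the vertices. For a full-dimensional simplex with the
  origin in its interior the vertices span the space, so the set of cosets is finite and
  \<open>card\<close> is the true index.\<close>

definition simplex_mult :: "(real ^ 'n) set \<Rightarrow> (real ^ 'n) set \<Rightarrow> nat" where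
  "simplex_mult N P =
     card (rcosets\<^bsub>lattice_group N\<^esub> (generate (lattice_group N) (vertices P)))"

text \<open>An automorphism of \<open>N\<close> is represented by its unique linear extension to the ambient space.\<close>

definition unimodular_equiv :: "(real ^ 'n) set \<Rightarrow> (real ^ 'n) set \<Rightarrow> (real ^ 'n) set \<Rightarrow> bool" where
  "unimodular_equiv N Q Q' \<longleftrightarrow>
     (\<exists>A w. linear A \<and> bij_betw A N N \<and> w \<in> N \<and> Q' = (\<lambda>x. A x + w) ` Q)"

end

theory Submission
  imports Defs "HOL-Real_Asymp.Real_Asymp"
begin

text \<open>Let \<open>v 0, \<dots>, v d\<close> be the vertices, \<open>b i\<close> the barycentric coordinates of the origin, with
  \<open>b 1 \<ge> \<dots> \<ge> b d \<ge> b 0\<close>, and \<open>c i\<close> the coordinates with respect to \<open>w i = v i - v 0\<close>. If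
  \<open>\<bar>c i x\<bar> < b i\<close> for all \<open>i\<close>, then \<open>x\<close> or \<open>- x\<close> lies in the interior of the simplex, so this box
  contains no nonzero lattice point. By pigeonhole the lattice has at most \<open>1 / (b 1 \<dots> b d)\<close> classes
  modulo the edge lattice, and every class modulo the vertex lattice splits into at least \<open>1 / b 0\<close>
  of them; hence the multiplicity is at most \<open>b 0 / (b 1 \<dots> b d)\<close>. The points \<open>- v i\<close> and
  \<open>- v i - v j\<close> show \<open>b 1 \<le> 1 / 2\<close> and \<open>b 2 \<le> 1 / 3\<close>, and under these constraints the quotient is
  maximal only at \<open>b = (1 / (d + 1), \<dots>)\<close> for \<open>d \<le> 3\<close>, and at \<open>(1 / 2, 1 / 8, \<dots>, 1 / 8)\<close> for
  \<open>d = 4\<close>. In the extremal case the boxes tile the space, which forces the vectors \<open>b i *\<^sub>R w i\<close>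
  to be a lattice basis.\<close>

section \<open>Pigeonhole principles on the torus\<close>

text \<open>Boxes with sides \<open>b i\<close> attached to the points \<open>c x\<close> have total
  volume above 1, so two of them meet modulo the integers. Volume is replaced by counting: on a grid
  with \<open>K\<close> steps per unit, the box of \<open>x\<close> takes up \<open>L i\<close>
  residues in direction \<open>i\<close>.\<close>

lemma torus_pigeonhole:
  fixes c :: "'a \<Rightarrow> 'i \<Rightarrow> real"
  assumes "finite I" "finite F" and b: "\<And>i. i \<in> I \<Longrightarrow> 0 < b i \<and> b i \<le> 1"
    and gt: "real (card F) * (\<Prod>i\<in>I. b i) > 1"
  shows "\<exists>x\<in>F. \<exists>y\<in>F. x \<noteq> y \<and> (\<forall>i\<in>I. \<exists>z::int. \<bar>c x i - c y i - of_int z\<bar> < b i)"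
proof -
  have "(\<lambda>K. real_of_int \<lfloor>real K * b i\<rfloor> / real K) \<longlonglongrightarrow> b i" for i
    by real_asymp
  then have "(\<lambda>K. real (card F) * (\<Prod>i\<in>I. real_of_int \<lfloor>real K * b i\<rfloor> / real K))
      \<longlonglongrightarrow> real (card F) * (\<Prod>i\<in>I. b i)"
    by (intro tendsto_intros)
  then have "\<forall>\<^sub>F K in sequentially. real (card F) * (\<Prod>i\<in>I. real_of_int \<lfloor>real K * b i\<rfloor> / real K) > 1"
    using gt by (rule order_tendstoD)
  then have "\<forall>\<^sub>F K in sequentially. K > 0 \<and>
      real (card F) * (\<Prod>i\<in>I. real_of_int \<lfloor>real K * b i\<rfloor> / real K) > 1"
    using eventually_gt_at_top[of 0] by eventually_elim simp
  \<comment> \<open>Rounding \<open>K * b i\<close> down loses a vanishing proportion, so the strict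
    inequality survives for large \<open>K\<close>.\<close>
  then obtain K :: nat where K: "K > 0"
    and K1: "real (card F) * (\<Prod>i\<in>I. real_of_int \<lfloor>real K * b i\<rfloor> / real K) > 1"
    using eventually_happens'[OF sequentially_bot] by blast
  define L where "L i = \<lfloor>real K * b i\<rfloor>" for i
  have L0: "0 \<le> L i" and LK: "L i \<le> int K" and Lb: "real_of_int (L i) \<le> real K * b i" if "i \<in> I" for i
  proof -
    show "0 \<le> L i" using b[OF that] by (simp add: L_def)
    show Lb: "real_of_int (L i) \<le> real K * b i" by (simp add: L_def)
    have "real K * b i \<le> real K" using b[OF that] by (simp add: mult_left_le)
    then show "L i \<le> int K" using Lb by linarith
  qed
  define D where "D = F \<times> (PiE I (\<lambda>i. {0..<L i}))"
  define E where "E = PiE I (\<lambda>i. {0..<int K})"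
  \<comment> \<open>\<open>f (x, j)\<close> is the grid cell number \<open>j\<close> of the box
    attached to \<open>x\<close>; a collision means that two boxes overlap.\<close>
  define f where "f = (\<lambda>(x, j). \<lambda>i\<in>I. (\<lfloor>real K * c x i\<rfloor> + j i) mod int K)"
  have "real (card D) = real (card F) * (\<Prod>i\<in>I. real_of_int (L i))"
    using L0 by (simp add: D_def card_cartesian_product card_PiE assms(1))
  moreover have "real (card E) = (\<Prod>i\<in>I. real K)"
    by (simp add: E_def card_PiE assms(1))
  moreover have "real (card F) * (\<Prod>i\<in>I. real_of_int (L i)) > (\<Prod>i\<in>I. real K)"
    using K1 K by (simp add: L_def prod_dividef field_simps)
  ultimately have "card E < card D" by linarith
  moreover have "finite E" by (simp add: E_def finite_PiE assms(1))
  moreover have "f ` D \<subseteq> E"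
    using K by (auto simp: f_def E_def)
  ultimately have "\<not> inj_on f D"
    using card_inj_on_le[of f D E] by linarith
  then obtain x j y k where xy: "(x, j) \<in> D" "(y, k) \<in> D" "(x, j) \<noteq> (y, k)" "f (x, j) = f (y, k)"
    unfolding inj_on_def by auto
  have jk: "0 \<le> j i" "j i < L i" "0 \<le> k i" "k i < L i" if "i \<in> I" for i
    using xy that by (auto simp: D_def PiE_iff)
  have md: "(\<lfloor>real K * c x i\<rfloor> + j i) mod int K = (\<lfloor>real K * c y i\<rfloor> + k i) mod int K" if "i \<in> I" for i
    using fun_cong[OF xy(4), of i] that by (simp add: f_def)
  \<comment> \<open>A single box does not overlap itself modulo \<open>K\<close>, since its side
    \<open>L i\<close> is at most \<open>K\<close>.\<close>
  have "x \<noteq> y"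
  proof
    assume eq: "x = y"
    have "j i = k i" if "i \<in> I" for i
    proof -
      have "int K dvd (\<lfloor>real K * c x i\<rfloor> + j i) - (\<lfloor>real K * c y i\<rfloor> + k i)"
        using md[OF that] by (simp add: mod_eq_dvd_iff)
      then have "int K dvd j i - k i" using eq by simp
      moreover have "\<bar>j i - k i\<bar> < int K" using jk[OF that] LK[OF that] by linarith
      ultimately show ?thesis using dvd_imp_le_int[of "j i - k i" "int K"] by fastforce
    qed
    then have "j = k"
      using xy(1,2) unfolding D_def by (auto intro: PiE_ext)
    then show False using eq xy(3) by simp
  qed
  moreover have "\<exists>z::int. \<bar>c x i - c y i - of_int z\<bar> < b i" if "i \<in> I" for i
  proof -
    have "int K dvd (\<lfloor>real K * c x i\<rfloor> + j i) - (\<lfloor>real K * c y i\<rfloor> + k i)"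
      using md[OF that] by (simp add: mod_eq_dvd_iff)
    then obtain z where z: "(\<lfloor>real K * c x i\<rfloor> + j i) - (\<lfloor>real K * c y i\<rfloor> + k i) = int K * z" by blast
    have 1: "real_of_int \<lfloor>real K * c x i\<rfloor> + j i - \<lfloor>real K * c y i\<rfloor> - k i = real K * z"
      using arg_cong[OF z, of real_of_int] by simp
    \<comment> \<open>The offsets differ by at most \<open>L i - 1\<close>, and the two floors
      change the difference by less than 1; together this gives a strict bound by
      \<open>L i\<close>.\<close>
    have 2: "\<bar>real_of_int (j i) - k i\<bar> \<le> real_of_int (L i) - 1"
      using jk[OF that] by linarith
    have "\<bar>real K * c x i - real K * c y i - real K * z\<bar> < L i"
      using 1 2 by linarith
    then have "\<bar>real K * (c x i - c y i - z)\<bar> < real K * b i"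
      using Lb[OF that] by (simp add: algebra_simps)
    then have "real K * \<bar>c x i - c y i - z\<bar> < real K * b i" by (simp add: abs_mult)
    then show ?thesis using K by auto
  qed
  ultimately show ?thesis using xy(1,2) by (auto simp: D_def)
qed

text \<open>Cut the torus into cells of sides \<open>1 / a i\<close>, one of which has its lower
  corner at \<open>g\<close>. Separation puts at most one point of \<open>F\<close> into each cell,
  and there are as many points as cells, so every cell is occupied, in particular the one at
  \<open>g\<close>.\<close>

lemma torus_cells:
  fixes c :: "'a \<Rightarrow> 'i \<Rightarrow> real" and a :: "'i \<Rightarrow> nat"
  assumes "finite I" and a: "\<And>i. i \<in> I \<Longrightarrow> a i > 0"
    and F: "card F = (\<Prod>i\<in>I. a i)"
    and sep: "\<And>x y. x \<in> F \<Longrightarrow> y \<in> F \<Longrightarrow>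
      (\<And>i. i \<in> I \<Longrightarrow> \<exists>z::int. \<bar>c x i - c y i - of_int z\<bar> < 1 / a i) \<Longrightarrow> x = y"
  shows "\<exists>x\<in>F. \<forall>i\<in>I. \<exists>z::int. 0 \<le> c x i - of_int z - g i \<and> c x i - of_int z - g i < 1 / a i"
proof -
  define f where "f x = (\<lambda>i\<in>I. \<lfloor>a i * (c x i - g i)\<rfloor> mod int (a i))" for x
  define E where "E = PiE I (\<lambda>i. {0..<int (a i)})"
  have "inj_on f F"
  proof (intro inj_onI sep)
    fix x y i assume "f x = f y" and i: "i \<in> I"
    then have "f x i = f y i" by simp
    then have "\<lfloor>a i * (c x i - g i)\<rfloor> mod int (a i) = \<lfloor>a i * (c y i - g i)\<rfloor> mod int (a i)"
      using i by (simp add: f_def)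
    then obtain z where "\<lfloor>a i * (c x i - g i)\<rfloor> - \<lfloor>a i * (c y i - g i)\<rfloor> = int (a i) * z"
      by (auto simp: mod_eq_dvd_iff)
    then have "real_of_int \<lfloor>a i * (c x i - g i)\<rfloor> - \<lfloor>a i * (c y i - g i)\<rfloor> = a i * z"
      by (metis of_int_diff of_int_mult of_int_of_nat_eq)
    then have "\<bar>a i * (c x i - g i) - a i * (c y i - g i) - a i * z\<bar> < 1" by linarith
    then have "\<bar>a i * (c x i - c y i - z)\<bar> < 1" by (simp add: algebra_simps)
    then have "\<bar>c x i - c y i - z\<bar> < 1 / a i" using a[OF i] by (simp add: abs_mult pos_less_divide_eq mult.commute)
    then show "\<exists>z::int. \<bar>c x i - c y i - of_int z\<bar> < 1 / a i" by blast
  qed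
  moreover have "f ` F \<subseteq> E" using a by (auto simp: f_def E_def)
  moreover have "card F = card E" by (simp add: F E_def card_PiE assms(1))
  moreover have "finite E" by (simp add: E_def finite_PiE assms(1))
  ultimately have "f ` F = E" using card_image[of f F] card_subset_eq[of E "f ` F"] by simp
  \<comment> \<open>The zero index labels the cell whose lower corner is \<open>g\<close>.\<close>
  moreover have "(\<lambda>i\<in>I. 0) \<in> E" using a by (auto simp: E_def)
  ultimately obtain x where x: "x \<in> F" "f x = (\<lambda>i\<in>I. 0)" by (metis imageE)
  show ?thesis
  proof (intro bexI[of _ x] ballI)
    fix i assume i: "i \<in> I"
    have "\<lfloor>a i * (c x i - g i)\<rfloor> mod int (a i) = 0"
      using fun_cong[OF x(2), of i] i by (simp add: f_def)
    then obtain z where "\<lfloor>a i * (c x i - g i)\<rfloor> = int (a i) * z" by (auto simp: mod_eq_0_iff_dvd)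
    then have "real_of_int \<lfloor>a i * (c x i - g i)\<rfloor> = a i * z" by simp
    then have "a i * z \<le> a i * (c x i - g i)" "a i * (c x i - g i) < a i * z + 1" by linarith+
    then have "0 \<le> a i * (c x i - z - g i)" "a i * (c x i - z - g i) < 1" by (simp_all add: algebra_simps)
    then show "\<exists>z::int. 0 \<le> c x i - of_int z - g i \<and> c x i - of_int z - g i < 1 / a i"
      using a[OF i]
      by (intro exI[of _ z]) (simp add: zero_le_mult_iff pos_less_divide_eq mult.commute)
  qed (rule x)
qed

section \<open>Canonical simplices in edge coordinates\<close>

text \<open>Coordinates are centred at the origin and run along the edges
  \<open>w i = v i - v 0\<close>. The barycentric coordinates of \<open>x\<close> are
  \<open>b i + c i x\<close> for \<open>i\<close> from 1 to \<open>d\<close>, and \<open>b 0\<close>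
  minus the sum of the \<open>c i x\<close> at \<open>v 0\<close>; so the inequalities in
  \<open>canonical\<close> say that \<open>x\<close> is interior. The point in
  \<open>apex_in\<close> is \<open>- v 0\<close>.\<close>

locale canonical_frame =
  fixes N :: "'a::real_vector set" and w :: "nat \<Rightarrow> 'a" and c :: "nat \<Rightarrow> 'a \<Rightarrow> real"
    and b :: "nat \<Rightarrow> real" and d :: nat
  assumes zero_in: "0 \<in> N"
    and diff_in: "\<And>x y. x \<in> N \<Longrightarrow> y \<in> N \<Longrightarrow> x - y \<in> N"
    and w_in: "\<And>i. i \<in> {1..d} \<Longrightarrow> w i \<in> N"
    and linear_c: "\<And>i. linear (c i)"
    and c_w: "\<And>i j. i \<in> {1..d} \<Longrightarrow> j \<in> {1..d} \<Longrightarrow> c i (w j) = (if i = j then 1 else 0)"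
    and expand: "\<And>x. x = (\<Sum>i=1..d. c i x *\<^sub>R w i)"
    and b_pos: "\<And>i. i \<le> d \<Longrightarrow> 0 < b i"
    and b_sum: "b 0 + (\<Sum>i=1..d. b i) = 1"
    and apex_in: "(\<Sum>i=1..d. b i *\<^sub>R w i) \<in> N"
    and canonical: "\<And>x. x \<in> N \<Longrightarrow> (\<And>i. i \<in> {1..d} \<Longrightarrow> - b i < c i x) \<Longrightarrow>
      (\<Sum>i=1..d. c i x) < b 0 \<Longrightarrow> x = 0"
begin

abbreviation apex :: 'a where "apex \<equiv> \<Sum>i=1..d. b i *\<^sub>R w i"

text \<open>Not every class has to be represented: the cardinality of such a set bounds the number
  of classes from below.\<close>

definition reps_mod_edges :: "'a set \<Rightarrow> bool" where
  "reps_mod_edges F \<longleftrightarrow> finite F \<and> F \<subseteq> N \<and>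
     (\<forall>x\<in>F. \<forall>y\<in>F. \<forall>z :: nat \<Rightarrow> int. x - y = (\<Sum>i=1..d. of_int (z i) *\<^sub>R w i) \<longrightarrow> x = y)"

lemma minus_in: "x \<in> N \<Longrightarrow> - x \<in> N"
  using diff_in[OF zero_in] by force

lemma add_in: "x \<in> N \<Longrightarrow> y \<in> N \<Longrightarrow> x + y \<in> N"
  using diff_in[OF _ minus_in] by force

lemma scale_nat_in: "x \<in> N \<Longrightarrow> real n *\<^sub>R x \<in> N"
  by (induction n) (auto simp: zero_in add_in scaleR_left_distrib)

lemma scale_int_in: "x \<in> N \<Longrightarrow> real_of_int k *\<^sub>R x \<in> N"
  by (cases k rule: int_cases2) (auto simp: scale_nat_in minus_in)

lemma sum_in: "(\<And>i. i \<in> S \<Longrightarrow> f i \<in> N) \<Longrightarrow> sum f S \<in> N"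
  by (induction S rule: infinite_finite_induct) (auto simp: zero_in add_in)

lemma c_sum:
  assumes "i \<in> {1..d}"
  shows "c i (\<Sum>j=1..d. f j *\<^sub>R w j) = f i"
proof -
  have "c i (\<Sum>j=1..d. f j *\<^sub>R w j) = (\<Sum>j=1..d. if i = j then f j else 0)"
    unfolding linear_sum[OF linear_c] using assms c_w
    by (intro sum.cong) (auto simp: linear_scale[OF linear_c])
  then show ?thesis using assms by simp
qed

lemma eq_zero_if_coords: "(\<And>i. i \<in> {1..d} \<Longrightarrow> c i x = 0) \<Longrightarrow> x = 0"
  by (subst expand[of x]) simp

lemmas c_simps = linear_diff[OF linear_c] linear_add[OF linear_c] linear_neg[OF linear_c]
  linear_scale[OF linear_c] linear_0[OF linear_c]
  c_sum[unfolded One_nat_def]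

lemma b_less_1:
  assumes "i \<in> {1..d}" shows "b i < 1"
proof -
  have "b i \<le> (\<Sum>i=1..d. b i)"
    using assms b_pos by (intro member_le_sum) (auto simp: less_imp_le)
  then show ?thesis using b_sum b_pos[of 0] by linarith
qed

text \<open>The box is symmetric, so the sign of \<open>x\<close> may be chosen to make the
  coordinate sum nonpositive. The inequality for the facet opposite \<open>v 0\<close> then holds
  because \<open>b 0\<close> is positive, and the other facets are handled by the box.\<close>

lemma box_trivial:
  assumes "x \<in> N" and "\<And>i. i \<in> {1..d} \<Longrightarrow> \<bar>c i x\<bar> < b i"
  shows "x = 0"
proof (cases "(\<Sum>i=1..d. c i x) \<le> 0")
  case True
  then show ?thesis using assms b_pos[of 0] by (intro canonical) (force simp: abs_less_iff)+
next
  case False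
  have "(\<Sum>i=1..d. c i (- x)) = - (\<Sum>i=1..d. c i x)"
    by (simp add: c_simps sum_negf)
  then have "- x = 0"
    using assms b_pos[of 0] False
    by (intro canonical minus_in) (force simp: abs_less_iff c_simps)+
  then show ?thesis by simp
qed

lemma eq_mod_edges:
  assumes "x \<in> N" "y \<in> N" and "\<And>i. i \<in> {1..d} \<Longrightarrow> \<exists>z::int. \<bar>c i x - c i y - of_int z\<bar> < b i"
  shows "\<exists>z :: nat \<Rightarrow> int. x - y = (\<Sum>i=1..d. of_int (z i) *\<^sub>R w i)"
proof -
  obtain z :: "nat \<Rightarrow> int" where z: "\<And>i. i \<in> {1..d} \<Longrightarrow> \<bar>c i x - c i y - of_int (z i)\<bar> < b i"
    using assms(3) by metis
  define u where "u = x - y - (\<Sum>i=1..d. of_int (z i) *\<^sub>R w i)"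
  have "u = 0"
  proof (rule box_trivial)
    show "u \<in> N" unfolding u_def by (intro diff_in sum_in scale_int_in w_in assms)
    show "\<bar>c i u\<bar> < b i" if "i \<in> {1..d}" for i
      using z[OF that] that by (simp add: u_def c_simps)
  qed
  then show ?thesis unfolding u_def by (intro exI[of _ z]) simp
qed

lemma reps_mod_edges_separated:
  assumes "reps_mod_edges F" "x \<in> F" "y \<in> F"
    and "\<And>i. i \<in> {1..d} \<Longrightarrow> \<exists>z::int. \<bar>c i x - c i y - of_int z\<bar> < b i"
  shows "x = y"
proof -
  have "x \<in> N" "y \<in> N" using assms(1-3) by (auto simp: reps_mod_edges_def)
  from eq_mod_edges[OF this assms(4)]
  obtain z :: "nat \<Rightarrow> int" where "x - y = (\<Sum>i=1..d. of_int (z i) *\<^sub>R w i)"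
    by auto
  then show ?thesis using assms(1-3) unfolding reps_mod_edges_def by blast
qed

section \<open>Counting lattice classes modulo the edge lattice\<close>

text \<open>A packing bound: in the coordinates \<open>c\<close> the edge lattice has a unit cell,
  and two distinct representatives are never as close as the box of sides \<open>b i\<close> would
  require for an overlap.\<close>

lemma card_reps_mod_edges:
  assumes "reps_mod_edges F"
  shows "real (card F) * (\<Prod>i=1..d. b i) \<le> 1"
proof (rule ccontr)
  assume "\<not> ?thesis"
  then have gt: "real (card F) * (\<Prod>i=1..d. b i) > 1" by simp
  have F: "finite F" using assms by (simp add: reps_mod_edges_def)
  have b: "0 < b i \<and> b i \<le> 1" if "i \<in> {1..d}" for i
    using b_pos b_less_1 that by (simp add: less_imp_le)
  obtain x y where xy: "x \<in> F" "y \<in> F" "x \<noteq> y"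
    and close: "\<forall>i\<in>{1..d}. \<exists>z::int. \<bar>c i x - c i y - of_int z\<bar> < b i"
    using torus_pigeonhole[OF finite_atLeastAtMost F b gt, of "\<lambda>x i. c i x"] by auto
  have "x = y" by (rule reps_mod_edges_separated[OF assms xy(1,2)]) (use close in blast)
  then show False using xy(3) by simp
qed

text \<open>The multiples \<open>k *\<^sub>R apex\<close> with \<open>k < 1 / b 0\<close> are distinct modulo the edge lattice, since the
  missing coordinate of \<open>k *\<^sub>R apex\<close> is \<open>k * b 0\<close> modulo 1.\<close>

lemma refine_reps:
  assumes "finite R" "R \<subseteq> N"
    and H: "\<And>x y. x \<in> H \<Longrightarrow> y \<in> H \<Longrightarrow> x + y \<in> H" "\<And>(z :: nat \<Rightarrow> int). (\<Sum>i=1..d. of_int (z i) *\<^sub>R w i) \<in> H"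
      "\<And>(k :: int). of_int k *\<^sub>R apex \<in> H"
    and R: "\<And>x y. x \<in> R \<Longrightarrow> y \<in> R \<Longrightarrow> x - y \<in> H \<Longrightarrow> x = y"
  obtains F where "reps_mod_edges F" "card F = card R * nat \<lceil>1 / b 0\<rceil>"
proof -
  define n where "n = nat \<lceil>1 / b 0\<rceil>"
  have b0: "0 < b 0" using b_pos by simp
  have n: "real n < 1 / b 0 + 1" unfolding n_def using b0 by (simp add: ceiling_less_iff of_nat_nat) linarith
  define f where "f = (\<lambda>(r, k::nat). r - real k *\<^sub>R apex)"
  have sep: "r = s \<and> k = l"
    if "r \<in> R" "s \<in> R" "k < n" "l < n"
      and eq: "f (r, k) - f (s, l) = (\<Sum>i=1..d. of_int (z i) *\<^sub>R w i)" for r s k l and z :: "nat \<Rightarrow> int"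
  proof -
    have rs: "r - s = (\<Sum>i=1..d. of_int (z i) *\<^sub>R w i) + of_int (int k - int l) *\<^sub>R apex"
      using eq by (simp add: f_def algebra_simps)
    have "r - s \<in> H" unfolding rs by (intro H)
    then have [simp]: "r = s" using R that by blast
    have "(real l - real k) * b i = z i" if "i \<in> {1..d}" for i
      using arg_cong[OF rs, of "c i"] that by (simp add: c_simps algebra_simps)
    then have "(real l - real k) * (\<Sum>i=1..d. b i) = (\<Sum>i=1..d. real_of_int (z i))"
      unfolding sum_distrib_left by (intro sum.cong) auto
    moreover have "(\<Sum>i=1..d. b i) = 1 - b 0" using b_sum by simp
    ultimately have "(real l - real k) * (1 - b 0) = (\<Sum>i=1..d. real_of_int (z i))"
      by simp
    then have "(real l - real k) * b 0 = of_int (int l - int k - (\<Sum>i=1..d. z i))"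
      by (simp add: algebra_simps)
    then obtain m :: int where int: "(real l - real k) * b 0 = of_int m" by blast
    \<comment> \<open>Since \<open>n - 1\<close> is below \<open>1 / b 0\<close>, the integer
      \<open>(l - k) * b 0\<close> has absolute value less than 1 and must vanish.\<close>
    have "\<bar>real l - real k\<bar> \<le> real n - 1" using that by linarith
    then have "\<bar>real l - real k\<bar> < 1 / b 0" using n by linarith
    then have "\<bar>(real l - real k) * b 0\<bar> < 1" using b0 by (simp add: abs_mult pos_less_divide_eq)
    then have "m = 0" unfolding int by linarith
    then show ?thesis using int b0 by simp
  qed
  have "inj_on f (R \<times> {..<n})"
  proof (rule inj_onI, clarsimp)
    fix r k s l assume "r \<in> R" "s \<in> R" "k < n" "l < n" "f (r, k) = f (s, l)"
    then show "r = s \<and> k = l" using sep[of r s k l "\<lambda>_. 0"] by simp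
  qed
  then have "card (f ` (R \<times> {..<n})) = card R * n"
    by (simp add: card_image card_cartesian_product)
  moreover have "reps_mod_edges (f ` (R \<times> {..<n}))"
    unfolding reps_mod_edges_def
  proof (intro conjI ballI allI impI)
    show "f ` (R \<times> {..<n}) \<subseteq> N"
      using assms(2) by (auto simp: f_def simp del: One_nat_def intro!: diff_in scale_nat_in apex_in)
    show "x = y" if "x \<in> f ` (R \<times> {..<n})" "y \<in> f ` (R \<times> {..<n})"
      "x - y = (\<Sum>i=1..d. of_int (z i) *\<^sub>R w i)" for x y and z :: "nat \<Rightarrow> int"
    proof -
      obtain r k s l where "x = f (r, k)" "y = f (s, l)" "r \<in> R" "s \<in> R" "k < n" "l < n"
        using \<open>x \<in> _\<close> \<open>y \<in> _\<close> by auto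
      then show ?thesis using sep[of r s k l z] \<open>x - y = _\<close> by simp
    qed
  qed (simp add: assms(1))
  ultimately show thesis using that unfolding n_def by blast
qed

section \<open>Upper bounds on the barycentric weights of the origin\<close>

text \<open>The test point \<open>apex - w i\<close> is the negative of the vertex
  \<open>v i\<close>. Its coordinate \<open>b i - 1\<close> exceeds \<open>- b i\<close> exactly
  when \<open>b i\<close> exceeds one half, and the other interior conditions follow from positivity
  of the weights.\<close>

lemma weight_le_half:
  assumes "i \<in> {1..d}" shows "b i \<le> 1 / 2"
proof (rule ccontr)
  assume "\<not> ?thesis"
  then have gt: "b i > 1 / 2" by simp
  define x where "x = apex - w i"
  have cx: "c j x = b j - (if j = i then 1 else 0)" if "j \<in> {1..d}" for j
    using that assms by (simp add: x_def c_simps c_w)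
  have "x = 0"
  proof (rule canonical)
    show "x \<in> N" unfolding x_def by (intro diff_in apex_in w_in assms)
    show "- b j < c j x" if "j \<in> {1..d}" for j
      using cx[OF that] gt b_pos[of j] that by auto
    have "(\<Sum>j=1..d. c j x) = (\<Sum>j=1..d. b j) - 1"
      using assms by (subst sum.cong[OF refl cx]) (auto simp: sum_subtractf)
    then show "(\<Sum>j=1..d. c j x) < b 0" using b_sum b_pos[of 0] by simp
  qed
  then show False using cx[OF assms] b_less_1[OF assms] by (simp add: c_simps)
qed

text \<open>The test point is \<open>- v i - v j\<close>. Its coordinates \<open>2 * b i - 1\<close>
  and \<open>2 * b j - 1\<close> satisfy the interior inequalities exactly when both weights exceed
  one third.\<close>

lemma two_weights_le_third:
  assumes "i \<in> {1..d}" "j \<in> {1..d}" "i \<noteq> j" shows "b i \<le> 1 / 3 \<or> b j \<le> 1 / 3"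
proof (rule ccontr)
  assume "\<not> ?thesis"
  then have gt: "b i > 1 / 3" "b j > 1 / 3" by auto
  define x where "x = 2 *\<^sub>R apex - w i - w j"
  have cx: "c l x = 2 * b l - (if l = i then 1 else 0) - (if l = j then 1 else 0)" if "l \<in> {1..d}" for l
    using that assms by (simp add: x_def c_simps c_w)
  have "x = 0"
  proof (rule canonical)
    show "x \<in> N" unfolding x_def using scale_nat_in[OF apex_in, of 2]
      by (intro diff_in w_in assms) simp
    show "- b l < c l x" if "l \<in> {1..d}" for l
      using cx[OF that] gt b_pos[of l] that assms(3) by auto
    have "(\<Sum>l=1..d. c l x) = 2 * (\<Sum>l=1..d. b l) - 2"
      using assms by (subst sum.cong[OF refl cx]) (auto simp: sum_subtractf sum_distrib_left)
    then show "(\<Sum>l=1..d. c l x) < b 0" using b_sum b_pos[of 0] by simp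
  qed
  \<comment> \<open>If the test point is the origin, the two weights already add up to 1 and leave
    nothing for \<open>b 0\<close>.\<close>
  then have "b i = 1 / 2" "b j = 1 / 2" using cx[of i] cx[of j] assms by (auto simp: c_simps)
  moreover have "b i + b j \<le> (\<Sum>l=1..d. b l)"
    using sum_mono2[of "{1..d}" "{i, j}" b] assms b_pos by (auto simp: less_imp_le)
  ultimately show False using b_sum b_pos[of 0] by simp
qed

text \<open>In the extremal case the lattice translates of the box \<open>0 \<le> c i x < 1 / a i\<close> tile the space.
  The translate covering \<open>- b j *\<^sub>R w j\<close> must start at that very point: an offset along \<open>w j\<close> would
  put a lattice point into the open box, and an offset in another direction would put one into the
  interior of the simplex, because \<open>b j = b 0\<close>.\<close>

lemma edge_fraction_in:
  assumes F: "reps_mod_edges F" "card F = (\<Prod>i=1..d. a i)"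
    and a: "\<And>i. i \<in> {1..d} \<Longrightarrow> b i = 1 / real (a i)"
    and j: "j \<in> {1..d}" "b j = b 0"
  shows "b j *\<^sub>R w j \<in> N"
proof -
  have a0: "a i > 0" if "i \<in> {1..d}" for i
    using a[OF that] b_pos[of i] that by (cases "a i") auto
  have "\<exists>x\<in>F. \<forall>i\<in>{1..d}. \<exists>z::int. 0 \<le> c i x - of_int z - (if i = j then - b j else 0)
      \<and> c i x - of_int z - (if i = j then - b j else 0) < 1 / a i"
  proof (rule torus_cells[where c = "\<lambda>x i. c i x"])
    show "x = y" if "x \<in> F" "y \<in> F"
      "\<And>i. i \<in> {1..d} \<Longrightarrow> \<exists>z::int. \<bar>c i x - c i y - of_int z\<bar> < 1 / a i" for x y
      by (rule reps_mod_edges_separated[OF F(1) that(1,2)]) (use that(3) a in force)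
  qed (use a0 F in auto)
  then obtain x z where x: "x \<in> F" and z: "\<forall>i\<in>{1..d}.
      0 \<le> c i x - of_int (z i :: int) - (if i = j then - b j else 0)
      \<and> c i x - of_int (z i) - (if i = j then - b j else 0) < 1 / a i"
    by metis
  \<comment> \<open>\<open>u\<close> is the lattice point found in the half-open cell that starts at
    \<open>- b j *\<^sub>R w j\<close>.\<close>
  define u where "u = x - (\<Sum>i=1..d. of_int (z i) *\<^sub>R w i)"
  have uN: "u \<in> N" unfolding u_def using x F(1)
    by (intro diff_in sum_in scale_int_in w_in) (auto simp: reps_mod_edges_def)
  have cu: "c i u = c i x - of_int (z i)" if "i \<in> {1..d}" for i
    using that by (simp add: u_def c_simps)
  have uj: "- b j \<le> c j u" "c j u < 0"
    using z[rule_format, OF j(1)] cu[OF j(1)] a[OF j(1)] by auto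
  have ui: "0 \<le> c i u" "c i u < b i" if "i \<in> {1..d}" "i \<noteq> j" for i
    using z[rule_format, OF that(1)] cu[OF that(1)] a[OF that(1)] that by auto
  have u0: "u \<noteq> 0" using uj by (auto simp: c_simps)
  have ujb: "c j u = - b j"
  proof (rule ccontr)
    assume "c j u \<noteq> - b j"
    then have "\<bar>c i u\<bar> < b i" if "i \<in> {1..d}" for i
      using ui[of i] uj that by (cases "i = j") auto
    then show False using box_trivial[OF uN] u0 by blast
  qed
  have "c i u = 0" if i: "i \<in> {1..d}" "i \<noteq> j" for i
  proof (rule ccontr)
    assume "c i u \<noteq> 0"
    then have "0 < c i u" using ui[OF i] by simp
    also have "c i u \<le> (\<Sum>i\<in>{1..d}-{j}. c i u)"
      using ui i by (intro member_le_sum) auto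
    finally have "- b j < (\<Sum>i=1..d. c i u)"
      using j(1) ujb by (simp add: sum.remove[of _ j])
    then have "(\<Sum>i=1..d. c i (- u)) < b 0" by (simp add: c_simps sum_negf j(2))
    moreover have "- b i < c i (- u)" if "i \<in> {1..d}" for i
      using ui[of i] ujb b_pos[of j] j(1) that by (cases "i = j") (auto simp: c_simps)
    ultimately have "- u = 0" using canonical[OF minus_in[OF uN]] by blast
    then show False using u0 by simp
  qed
  then have "u + b j *\<^sub>R w j = 0"
    using ujb j(1) by (intro eq_zero_if_coords) (auto simp: c_simps c_w)
  then have "b j *\<^sub>R w j = - u" by (simp add: eq_neg_iff_add_eq_0 add.commute)
  then show ?thesis using minus_in[OF uN] by simp
qed

text \<open>Rounding down the coordinates with respect to the vectors
  \<open>b i *\<^sub>R w i\<close> leaves a lattice point with \<open>c i\<close> between 0 and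
  \<open>b i\<close>, which \<open>box_trivial\<close> forces to be zero.\<close>

lemma lattice_eq_if_edge_fractions_in:
  assumes "\<And>i. i \<in> {1..d} \<Longrightarrow> b i *\<^sub>R w i \<in> N"
  shows "N = range (\<lambda>k :: nat \<Rightarrow> int. \<Sum>i=1..d. of_int (k i) *\<^sub>R (b i *\<^sub>R w i))"
proof (intro subset_antisym subsetI)
  fix x assume x: "x \<in> N"
  define k where "k i = \<lfloor>c i x / b i\<rfloor>" for i
  define u where "u = x - (\<Sum>i=1..d. of_int (k i) *\<^sub>R (b i *\<^sub>R w i))"
  have "u = 0"
  proof (rule box_trivial)
    show "u \<in> N" unfolding u_def by (intro diff_in x sum_in scale_int_in assms)
    fix i assume i: "i \<in> {1..d}"
    have cu: "c i u = c i x - k i * b i"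
      using c_sum[OF i, of "\<lambda>i. k i * b i"] by (simp add: u_def c_simps)
    have "k i \<le> c i x / b i" "c i x / b i < k i + 1" unfolding k_def by linarith+
    then show "\<bar>c i u\<bar> < b i" using cu b_pos[of i] i by (simp add: field_simps)
  qed
  then show "x \<in> range (\<lambda>k :: nat \<Rightarrow> int. \<Sum>i=1..d. of_int (k i) *\<^sub>R (b i *\<^sub>R w i))"
    unfolding u_def by (intro range_eqI[of _ _ k]) simp
qed (use assms in \<open>auto simp del: scaleR_scaleR intro!: sum_in scale_int_in\<close>)

text \<open>The tiling argument covers every direction whose weight equals \<open>b 0\<close>. The
  one remaining direction \<open>j\<close> is obtained by subtracting the others from
  \<open>apex\<close>; this admits a single exceptional weight, as occurs in dimension 4.\<close>

lemma extremal_lattice: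
  assumes F: "reps_mod_edges F" "card F = (\<Prod>i=1..d. a i)"
    and a: "\<And>i. i \<in> {1..d} \<Longrightarrow> b i = 1 / real (a i)"
    and j: "j \<in> {1..d}" "\<And>i. i \<in> {1..d} \<Longrightarrow> i \<noteq> j \<Longrightarrow> b i = b 0"
  shows "N = range (\<lambda>k :: nat \<Rightarrow> int. \<Sum>i=1..d. of_int (k i) *\<^sub>R (b i *\<^sub>R w i))"
proof (rule lattice_eq_if_edge_fractions_in)
  have rest: "b i *\<^sub>R w i \<in> N" if "i \<in> {1..d}" "i \<noteq> j" for i
    using edge_fraction_in[OF F a] that j by blast
  have "b j *\<^sub>R w j = apex - (\<Sum>i\<in>{1..d}-{j}. b i *\<^sub>R w i)"
    using j(1) by (simp add: sum.remove[of _ j])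
  also have "\<dots> \<in> N" using rest by (intro diff_in apex_in sum_in) auto
  finally show "b i *\<^sub>R w i \<in> N" if "i \<in> {1..d}" for i using rest that by (cases "i = j") auto
qed

end

section \<open>Optimal weights\<close>

text \<open>The weights are eliminated from the smallest upwards. Replacing \<open>s\<close> by
  \<open>t\<close> gives \<open>m * (x * y * z) \<le> 1\<close>, and \<open>z\<close> is at least a
  third of \<open>1 - x - y\<close>, so \<open>m * (x * y * (1 - x - y)) \<le> 3\<close>. It remains
  to show that this product of weights is at least \<open>3 / 128\<close>, first varying
  \<open>y\<close> and then \<open>x\<close>.\<close>

lemma four_weights_bound:
  fixes x y z t s m :: real
  assumes ord: "y \<le> x" "z \<le> y" "t \<le> z" "s \<le> t" "0 < s" and sum: "s + (x + y + z + t) = 1"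
    and x: "x \<le> 1 / 2" and y: "y \<le> 1 / 3" and m: "0 \<le> m" "m * (x * y * z * t) \<le> s"
  shows "m \<le> 128" and "m = 128 \<Longrightarrow> x = 1 / 2 \<and> y = 1 / 8 \<and> z = 1 / 8 \<and> t = 1 / 8 \<and> s = 1 / 8"
proof -
  have "m * (x * y * z) * t \<le> 1 * t" using m(2) ord unfolding mult.assoc mult_1_left by linarith
  then have "m * (x * y * z) \<le> 1" by (rule mult_right_le_imp_le) (use ord in auto)
  moreover have "m * (x * y) * (1 - x - y) \<le> m * (x * y) * (3 * z)"
    using m(1) ord sum by (intro mult_left_mono) auto
  ultimately have m1: "m * (x * y * (1 - x - y)) \<le> 3" by (simp add: algebra_simps)
  \<comment> \<open>For fixed \<open>x\<close> the expression \<open>y * (1 - x - y)\<close> is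
    concave in \<open>y\<close> and takes the same value at \<open>(1 - x) / 4\<close> and
    \<open>3 * (1 - x) / 4\<close>. The first is a lower bound because \<open>y\<close> is the
    largest of four numbers with sum \<open>1 - x\<close>; the second is at least
    \<open>3 / 8\<close>, hence above \<open>y\<close>.\<close>
  have "0 \<le> (y - (1 - x) / 4) * (3 * (1 - x) / 4 - y)"
    using ord sum x y by (intro mult_nonneg_nonneg) (auto simp: field_simps)
  then have "3 * (1 - x)\<^sup>2 / 16 \<le> y * (1 - x - y)"
    by (simp add: power2_eq_square field_simps)
  then have "x * (3 * (1 - x)\<^sup>2 / 16) \<le> x * (y * (1 - x - y))"
    using ord by (intro mult_left_mono) auto
  then have xy: "3 / 16 * (x * (1 - x)\<^sup>2) \<le> x * y * (1 - x - y)" by (simp add: mult.assoc)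
  \<comment> \<open>The factor \<open>1 / 2 - x\<close> exhibits the equality case; the cofactor is
    positive on the range from \<open>1 / 5\<close> to \<open>1 / 2\<close>, and
    \<open>x \<ge> 1 / 5\<close> since \<open>x\<close> is the largest of five weights.\<close>
  have fac: "x * (1 - x)\<^sup>2 - 1 / 8 = (1 / 2 - x) * (3 / 2 * x - x\<^sup>2 - 1 / 4)"
    by (simp add: power2_eq_square field_simps)
  have "0 \<le> (x - 1 / 5) * (1 / 2 - x)"
    using ord sum x by (intro mult_nonneg_nonneg) auto
  then have pos: "3 / 2 * x - x\<^sup>2 - 1 / 4 > 0"
    using ord sum by (simp add: power2_eq_square field_simps)
  then have cub: "1 / 8 \<le> x * (1 - x)\<^sup>2"
    using fac x by (smt (verit) mult_nonneg_nonneg)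
  have "m * (3 / 128) \<le> m * (x * y * (1 - x - y))"
    using xy cub m(1) by (intro mult_left_mono) auto
  then show "m \<le> 128" using m1 by simp
  assume "m = 128"
  then have le: "x * y * (1 - x - y) \<le> 3 / 128" using m1 by simp
  then have "(1 / 2 - x) * (3 / 2 * x - x\<^sup>2 - 1 / 4) \<le> 0" using fac xy by linarith
  then have x2: "x = 1 / 2" using pos x by (auto simp: mult_le_0_iff)
  \<comment> \<open>The second root \<open>3 / 8\<close> is excluded by
    \<open>y \<le> 1 / 3\<close>. Once \<open>y = 1 / 8\<close>, the largest of four weights with
    sum \<open>1 / 2\<close> equals their average, so all four agree.\<close>
  then have "(y - 1 / 8) * (3 / 8 - y) \<le> 0" using le unfolding x2 by (simp add: field_simps)
  moreover have "1 / 8 \<le> y" using x2 sum ord by simp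
  ultimately have "y = 1 / 8" using y by (auto simp: mult_le_0_iff)
  then show "x = 1 / 2 \<and> y = 1 / 8 \<and> z = 1 / 8 \<and> t = 1 / 8 \<and> s = 1 / 8"
    using x2 sum ord by simp
qed

text \<open>The same elimination with one weight fewer leads to
  \<open>m * (x * (1 - x)) \<le> 3\<close>, and \<open>x * (1 - x)\<close> is at least
  \<open>3 / 16\<close> between \<open>1 / 4\<close> and \<open>3 / 4\<close>.\<close>

lemma three_weights_bound:
  fixes x y z s m :: real
  assumes ord: "y \<le> x" "z \<le> y" "s \<le> z" "0 < s" and sum: "s + (x + y + z) = 1"
    and x: "x \<le> 1 / 2" and m: "0 \<le> m" "m * (x * y * z) \<le> s"
  shows "m \<le> 16" and "m = 16 \<Longrightarrow> x = 1 / 4 \<and> y = 1 / 4 \<and> z = 1 / 4 \<and> s = 1 / 4"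
proof -
  have "m * (x * y) * z \<le> 1 * z" using m(2) ord unfolding mult.assoc mult_1_left by linarith
  then have "m * (x * y) \<le> 1" by (rule mult_right_le_imp_le) (use ord in auto)
  moreover have "m * x * (1 - x) \<le> m * x * (3 * y)"
    using m(1) ord sum by (intro mult_left_mono) auto
  ultimately have m1: "m * (x * (1 - x)) \<le> 3" by (simp add: algebra_simps)
  have fac: "x * (1 - x) - 3 / 16 = (x - 1 / 4) * (3 / 4 - x)" by (simp add: field_simps)
  moreover have "0 \<le> (x - 1 / 4) * (3 / 4 - x)"
    using ord sum x by (intro mult_nonneg_nonneg) auto
  ultimately have "m * (3 / 16) \<le> m * (x * (1 - x))"
    using m(1) by (intro mult_left_mono) auto
  then show "m \<le> 16" using m1 by simp
  assume "m = 16"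
  then have "(x - 1 / 4) * (3 / 4 - x) \<le> 0" using m1 fac by simp
  then have "x = 1 / 4" using x ord sum by (auto simp: mult_le_0_iff)
  then show "x = 1 / 4 \<and> y = 1 / 4 \<and> z = 1 / 4 \<and> s = 1 / 4"
    using sum ord by simp
qed

lemma two_weights_bound:
  fixes x y s m :: real
  assumes ord: "y \<le> x" "s \<le> y" "0 < s" and sum: "s + (x + y) = 1"
    and m: "0 \<le> m" "m * (x * y) \<le> s"
  shows "m \<le> 3" and "m = 3 \<Longrightarrow> x = 1 / 3 \<and> y = 1 / 3 \<and> s = 1 / 3"
proof -
  have "m * x * y \<le> 1 * y" using m(2) ord unfolding mult.assoc mult_1_left by linarith
  then have m1: "m * x \<le> 1" by (rule mult_right_le_imp_le) (use ord in auto)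
  have "m * (1 / 3) \<le> m * x" using m(1) ord sum by (intro mult_left_mono) auto
  then show "m \<le> 3" using m1 by simp
  assume "m = 3"
  then show "x = 1 / 3 \<and> y = 1 / 3 \<and> s = 1 / 3" using m1 ord sum by simp
qed

context canonical_frame
begin

text \<open>Up to dimension 2 the ordering of the weights gives the bound; dimension 3 also draws on
  the canonical bound \<open>1 / 2\<close>, and dimension 4 on both \<open>1 / 2\<close> and
  \<open>1 / 3\<close>.\<close>

lemma mult_le_of_weights:
  assumes dec: "\<And>i j. 1 \<le> i \<Longrightarrow> i \<le> j \<Longrightarrow> j \<le> d \<Longrightarrow> b j \<le> b i" "\<And>i. i \<in> {1..d} \<Longrightarrow> b 0 \<le> b i"
    and d: "1 \<le> d" and m: "0 \<le> m" "m * (\<Prod>i=1..d. b i) \<le> b 0"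
  shows "d \<le> 3 \<Longrightarrow> m \<le> real (d + 1) ^ (d - 1)"
    and "d \<le> 3 \<Longrightarrow> m = real (d + 1) ^ (d - 1) \<Longrightarrow> i \<le> d \<Longrightarrow> b i = 1 / real (d + 1)"
    and "d = 4 \<Longrightarrow> m \<le> 128"
    and "d = 4 \<Longrightarrow> m = 128 \<Longrightarrow> i \<le> d \<Longrightarrow> b i = (if i = 1 then 1 / 2 else 1 / 8)"
proof -
  have b0: "0 < b 0" using b_pos by simp
  have half: "b 1 \<le> 1 / 2" using weight_le_half d by simp
  have "(m \<le> real (d + 1) ^ (d - 1) \<and>
      (m = real (d + 1) ^ (d - 1) \<longrightarrow> (\<forall>i\<le>d. b i = 1 / real (d + 1))))" if "d \<le> 3"
  proof -
    have "d = 1 \<or> d = 2 \<or> d = 3" using d that by arith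
    then consider "d = 1" | "d = 2" | "d = 3" by blast
    then show ?thesis
    proof cases
      case 1
      then have eqs: "m * b 1 \<le> b 0" "b 0 \<le> b 1" "b 0 + b 1 = 1"
        using m(2) dec(2)[of 1] b_sum by auto
      have "m * b 1 \<le> 1 * b 1" using eqs unfolding mult_1_left by linarith
      then have "m \<le> 1" by (rule mult_right_le_imp_le) (use eqs b0 in linarith)
      moreover have "b 1 = 1 / 2" "b 0 = 1 / 2" if "m = 1" using that eqs by auto
      moreover have "i = 0 \<or> i = 1" if "i \<le> d" for i using that 1 by auto
      ultimately show ?thesis using 1 by fastforce
    next
      case 2
      have "{1..d} = {1, 2}" using 2 by auto
      then have "b 0 + (b 1 + b 2) = 1" "m * (b 1 * b 2) \<le> b 0" using b_sum m(2) by simp_all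
      moreover have "b 2 \<le> b 1" "b 0 \<le> b 2" using dec 2 by simp_all
      ultimately have "m \<le> 3 \<and> (m = 3 \<longrightarrow> b 1 = 1 / 3 \<and> b 2 = 1 / 3 \<and> b 0 = 1 / 3)"
        using two_weights_bound[of "b 2" "b 1" "b 0" m] b0 m(1) by blast
      then show ?thesis using 2 by (auto simp: le_Suc_eq numeral_2_eq_2)
    next
      case 3
      have "{1..d} = {1, 2, 3}" using 3 by auto
      then have "b 0 + (b 1 + b 2 + b 3) = 1" "m * (b 1 * b 2 * b 3) \<le> b 0"
        using b_sum m(2) by (simp_all add: mult.assoc)
      moreover have "b 2 \<le> b 1" "b 3 \<le> b 2" "b 0 \<le> b 3" using dec 3 by simp_all
      ultimately have "m \<le> 16 \<and> (m = 16 \<longrightarrow> b 1 = 1 / 4 \<and> b 2 = 1 / 4 \<and> b 3 = 1 / 4 \<and> b 0 = 1 / 4)"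
        using three_weights_bound[of "b 2" "b 1" "b 3" "b 0" m] b0 m(1) half by blast
      moreover have "i = 0 \<or> i = 1 \<or> i = 2 \<or> i = 3" if "i \<le> d" for i using that 3 by auto
      ultimately show ?thesis using 3 by fastforce
    qed
  qed
  then show "d \<le> 3 \<Longrightarrow> m \<le> real (d + 1) ^ (d - 1)"
    "d \<le> 3 \<Longrightarrow> m = real (d + 1) ^ (d - 1) \<Longrightarrow> i \<le> d \<Longrightarrow> b i = 1 / real (d + 1)" by blast+
  have "m \<le> 128 \<and> (m = 128 \<longrightarrow> (\<forall>i\<le>d. b i = (if i = 1 then 1 / 2 else 1 / 8)))" if 4: "d = 4"
  proof -
    have "{1..d} = {1, 2, 3, 4}" using 4 by auto
    then have "b 0 + (b 1 + b 2 + b 3 + b 4) = 1" "m * (b 1 * b 2 * b 3 * b 4) \<le> b 0"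
      using b_sum m(2) by (simp_all add: mult.assoc)
    moreover have "b 2 \<le> b 1" "b 3 \<le> b 2" "b 4 \<le> b 3" "b 0 \<le> b 4" using dec 4 by simp_all
    \<comment> \<open>One of the two largest weights is at most \<open>1 / 3\<close>, and
      \<open>b 2\<close> is the smaller of them.\<close>
    moreover have "b 2 \<le> 1 / 3" using two_weights_le_third[of 1 2] dec(1)[of 1 2] 4 by auto
    ultimately have "m \<le> 128 \<and> (m = 128 \<longrightarrow>
        b 1 = 1 / 2 \<and> b 2 = 1 / 8 \<and> b 3 = 1 / 8 \<and> b 4 = 1 / 8 \<and> b 0 = 1 / 8)"
      using four_weights_bound[of "b 2" "b 1" "b 3" "b 4" "b 0" m] b0 m(1) half by blast
    moreover have "i = 0 \<or> i = 1 \<or> i = 2 \<or> i = 3 \<or> i = 4" if "i \<le> d" for i using that 4 by auto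
    ultimately show ?thesis by fastforce
  qed
  then show "d = 4 \<Longrightarrow> m \<le> 128"
    "d = 4 \<Longrightarrow> m = 128 \<Longrightarrow> i \<le> d \<Longrightarrow> b i = (if i = 1 then 1 / 2 else 1 / 8)" by blast+
qed

end

section \<open>Dual bases and barycentric coordinates of interior points\<close>

lemma dual_family:
  fixes w :: "nat \<Rightarrow> real ^ 'n"
  assumes "inj_on w {1..CARD('n)}" "independent (w ` {1..CARD('n)})"
  obtains c where "\<And>i. linear (c i)"
    "\<And>i j. i \<in> {1..CARD('n)} \<Longrightarrow> j \<in> {1..CARD('n)} \<Longrightarrow> c i (w j) = (if i = j then 1 else 0 :: real)"
    "\<And>x. x = (\<Sum>i=1..CARD('n). c i x *\<^sub>R w i)"
proof -
  have "\<exists>g. linear g \<and> (\<forall>j\<in>{1..CARD('n)}. g (w j) = (if i = j then 1 else 0 :: real))" for i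
  proof -
    \<comment> \<open>Linear extension takes a function on vectors, so \<open>inv_into\<close>
      recovers the index of a basis vector.\<close>
    obtain g where "linear g" "\<forall>x\<in>w ` {1..CARD('n)}. g x = (if i = inv_into {1..CARD('n)} w x then 1 else 0 :: real)"
      using linear_independent_extend[OF assms(2), of "\<lambda>x. if i = inv_into {1..CARD('n)} w x then 1 else 0 :: real"]
      by blast
    then show ?thesis using inv_into_f_f[OF assms(1)] by (intro exI[of _ g]) simp
  qed
  then obtain c where lin: "\<And>i. linear (c i)"
    and cw: "\<And>i j. j \<in> {1..CARD('n)} \<Longrightarrow> c i (w j) = (if i = j then 1 else 0 :: real)"
    by metis
  have span: "span (w ` {1..CARD('n)}) = UNIV"
    using card_ge_dim_independent[OF subset_UNIV assms(2)] assms(1)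
    by (auto simp: card_image)
  have "x = (\<Sum>i=1..CARD('n). c i x *\<^sub>R w i)" for x
  proof (rule linear_eq_on_span[of "\<lambda>x. x" _ "w ` {1..CARD('n)}"])
    show "linear (\<lambda>x. \<Sum>i=1..CARD('n). c i x *\<^sub>R w i)"
      by (intro linear_compose_sum ballI linearI)
        (simp_all add: linear_add[OF lin] linear_scale[OF lin] scaleR_left_distrib)
    fix y assume "y \<in> w ` {1..CARD('n)}"
    then obtain j where j: "j \<in> {1..CARD('n)}" "y = w j" by blast
    have "(\<Sum>i=1..CARD('n). c i y *\<^sub>R w i) = (\<Sum>i=1..CARD('n). if i = j then w i else 0)"
      using j by (intro sum.cong) (auto simp: cw)
    then show "y = (\<Sum>i=1..CARD('n). c i y *\<^sub>R w i)" using j by simp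
  qed (use span in \<open>auto simp: linear_id[unfolded id_def]\<close>)
  then show thesis using that lin cw by blast
qed

text \<open>Weights attached to the vertices as points are transferred to weights attached to their
  indices, which the injectivity of \<open>v\<close> allows.\<close>

lemma interior_simplex_explicit:
  fixes v :: "nat \<Rightarrow> real ^ 'n"
  assumes v: "inj_on v {0..CARD('n)}" "\<not> affine_dependent (v ` {0..CARD('n)})"
  shows "y \<in> interior (convex hull (v ` {0..CARD('n)})) \<longleftrightarrow>
    (\<exists>u. (\<forall>i\<in>{0..CARD('n)}. 0 < u i) \<and> sum u {0..CARD('n)} = 1 \<and>
      (\<Sum>i=0..CARD('n). u i *\<^sub>R v i) = y)" (is "_ \<longleftrightarrow> ?R")
proof -
  have "y \<in> interior (convex hull (v ` {0..CARD('n)})) \<longleftrightarrow>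
    (\<exists>u. (\<forall>x\<in>v ` {0..CARD('n)}. 0 < u x) \<and> sum u (v ` {0..CARD('n)}) = 1 \<and>
      (\<Sum>x\<in>v ` {0..CARD('n)}. u x *\<^sub>R x) = y)"
    using v by (simp add: interior_convex_hull_explicit_minimal card_image)
  also have "\<dots> \<longleftrightarrow> ?R"
  proof
    assume "\<exists>u. (\<forall>x\<in>v ` {0..CARD('n)}. 0 < u x) \<and> sum u (v ` {0..CARD('n)}) = 1 \<and>
      (\<Sum>x\<in>v ` {0..CARD('n)}. u x *\<^sub>R x) = y"
    then obtain u where "\<forall>x\<in>v ` {0..CARD('n)}. 0 < u x" "sum u (v ` {0..CARD('n)}) = 1"
      "(\<Sum>x\<in>v ` {0..CARD('n)}. u x *\<^sub>R x) = y" by blast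
    then show ?R by (intro exI[of _ "u \<circ> v"]) (auto simp: sum.reindex[OF v(1)])
  next
    assume ?R
    then obtain u where u: "\<forall>i\<in>{0..CARD('n)}. 0 < u i" "sum u {0..CARD('n)} = 1"
      "(\<Sum>i=0..CARD('n). u i *\<^sub>R v i) = y" by blast
    define u' where "u' = u \<circ> inv_into {0..CARD('n)} v"
    have u': "u' (v i) = u i" if "i \<in> {0..CARD('n)}" for i
      using that inv_into_f_f[OF v(1)] by (simp add: u'_def)
    then have "(\<Sum>i=0..CARD('n). u' (v i)) = sum u {0..CARD('n)}"
      "(\<Sum>i=0..CARD('n). u' (v i) *\<^sub>R v i) = (\<Sum>i=0..CARD('n). u i *\<^sub>R v i)"
      by (auto intro!: sum.cong)
    then show "\<exists>u. (\<forall>x\<in>v ` {0..CARD('n)}. 0 < u x) \<and> sum u (v ` {0..CARD('n)}) = 1 \<and>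
      (\<Sum>x\<in>v ` {0..CARD('n)}. u x *\<^sub>R x) = y"
      using u u' by (intro exI[of _ u']) (auto simp: sum.reindex[OF v(1)])
  qed
  finally show ?thesis .
qed

lemma sum_atLeast0_atMost_split:
  fixes f :: "nat \<Rightarrow> 'a::comm_monoid_add"
  shows "(\<Sum>i=0..d. f i) = f 0 + (\<Sum>i=1..d. f i)"
  using sum.atLeast_Suc_atMost[of 0 d f] by simp

text \<open>Sending \<open>f x\<close> to \<open>g x\<close> is a well-defined bijection of the
  images. This lets cosets be counted through any invariant that separates exactly the same
  classes.\<close>

lemma card_image_eq_if_same_kernel:
  assumes "\<And>x y. x \<in> A \<Longrightarrow> y \<in> A \<Longrightarrow> f x = f y \<longleftrightarrow> g x = g y"
  shows "card (f ` A) = card (g ` A)"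
proof (rule bij_betw_same_card)
  have inv: "inv_into A f (f x) \<in> A \<and> f (inv_into A f (f x)) = f x" if "x \<in> A" for x
    using that by (simp add: inv_into_into f_inv_into_f)
  then have "g (inv_into A f (f x)) = g x" if "x \<in> A" for x
    using assms that by blast
  then show "bij_betw (\<lambda>y. g (inv_into A f y)) (f ` A) (g ` A)"
    using assms by (auto simp: bij_betw_def inj_on_def image_image)
qed

section \<open>Cosets of the vertex lattice\<close>

lemma zero_in_lattice: "is_lattice_basis e N \<Longrightarrow> 0 \<in> N"
  by (auto simp: is_lattice_basis_def intro!: range_eqI[of _ _ "\<lambda>_. 0"])

lemma diff_in_lattice:
  assumes "is_lattice_basis e N" "x \<in> N" "y \<in> N"
  shows "x - y \<in> N"
proof -
  let ?f = "\<lambda>c :: nat \<Rightarrow> int. \<Sum>i=1..CARD('a). of_int (c i) *\<^sub>R e i"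
  have N: "N = range ?f" using assms(1) by (simp add: is_lattice_basis_def)
  obtain k l where "x = ?f k" "y = ?f l" using assms(2,3) unfolding N by blast
  then have "x - y = ?f (\<lambda>i. k i - l i)" by (simp add: sum_subtractf scaleR_left_diff_distrib)
  then show ?thesis unfolding N by (intro range_eqI[of _ _ "\<lambda>i. k i - l i"])
qed

lemma uminus_in_lattice: "is_lattice_basis e N \<Longrightarrow> x \<in> N \<Longrightarrow> - x \<in> N"
  using diff_in_lattice[OF _ zero_in_lattice] by fastforce

lemma add_in_lattice: "is_lattice_basis e N \<Longrightarrow> x \<in> N \<Longrightarrow> y \<in> N \<Longrightarrow> x + y \<in> N"
  using diff_in_lattice[OF _ _ uminus_in_lattice] by fastforce

lemma group_lattice_group:
  assumes "is_lattice_basis e N"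
  shows "group (lattice_group N)"
proof (rule groupI)
  fix x assume "x \<in> carrier (lattice_group N)"
  then show "\<exists>y\<in>carrier (lattice_group N). y \<otimes>\<^bsub>lattice_group N\<^esub> x = \<one>\<^bsub>lattice_group N\<^esub>"
    using uminus_in_lattice[OF assms] by (intro bexI[of _ "- x"]) (auto simp: lattice_group_def)
qed (use zero_in_lattice[OF assms] add_in_lattice[OF assms] in \<open>auto simp: lattice_group_def add.assoc\<close>)

lemma inv_lattice_group:
  assumes "is_lattice_basis e N" "x \<in> N"
  shows "inv\<^bsub>lattice_group N\<^esub> x = - x"
proof -
  interpret group "lattice_group N" by (rule group_lattice_group[OF assms(1)])
  show ?thesis
    using uminus_in_lattice[OF assms] assms(2)
    by (intro inv_equality) (auto simp: lattice_group_def)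
qed

text \<open>Induction over a generated subgroup in additive form: the inverse of a generator appears
  as \<open>- x\<close>, and both summands are known to lie in \<open>N\<close>.\<close>

lemma generate_induct [consumes 3, case_names zero gen uminus add]:
  assumes N: "is_lattice_basis e N" and "S \<subseteq> N" and x: "x \<in> generate (lattice_group N) S"
    and "P 0" "\<And>x. x \<in> S \<Longrightarrow> P x" "\<And>x. x \<in> S \<Longrightarrow> P (- x)"
    and "\<And>x y. x \<in> N \<Longrightarrow> y \<in> N \<Longrightarrow> P x \<Longrightarrow> P y \<Longrightarrow> P (x + y)"
  shows "P x"
proof -
  interpret group "lattice_group N" by (rule group_lattice_group[OF N])
  have in_N: "y \<in> N" if "y \<in> generate (lattice_group N) S" for y
    using generate_in_carrier[OF _ that] assms(2) by (simp add: lattice_group_def)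
  show ?thesis
    using x
  proof (induction rule: generate.induct)
    case (inv h)
    then show ?case using assms by (simp add: inv_lattice_group[OF N] subset_iff)
  next
    case (eng g h)
    then show ?case using assms(7) in_N by (simp add: lattice_group_def)
  qed (use assms in \<open>auto simp: lattice_group_def\<close>)
qed

lemma generate_lattice:
  assumes N: "is_lattice_basis e N" and S: "S \<subseteq> N"
  defines "H \<equiv> generate (lattice_group N) S"
  shows "H \<subseteq> N" "0 \<in> H" "S \<subseteq> H"
    and "\<And>x y. x \<in> H \<Longrightarrow> y \<in> H \<Longrightarrow> x + y \<in> H"
    and "\<And>x y. x \<in> H \<Longrightarrow> y \<in> H \<Longrightarrow> x - y \<in> H"
    and "\<And>(k :: int) x. x \<in> H \<Longrightarrow> of_int k *\<^sub>R x \<in> H"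
    and "\<And>(I :: 'i set) f. (\<And>i. i \<in> I \<Longrightarrow> f i \<in> H) \<Longrightarrow> sum f I \<in> H"
proof -
  interpret group "lattice_group N" by (rule group_lattice_group[OF N])
  have sub: "subgroup H (lattice_group N)"
    unfolding H_def by (rule generate_is_subgroup) (use S in \<open>simp add: lattice_group_def\<close>)
  show HN: "H \<subseteq> N" using subgroup.subset[OF sub] by (simp add: lattice_group_def)
  show zero: "0 \<in> H" using subgroup.one_closed[OF sub] by (simp add: lattice_group_def)
  show "S \<subseteq> H" unfolding H_def by (auto intro: generate.incl)
  show add: "x + y \<in> H" if "x \<in> H" "y \<in> H" for x y
    using subgroup.m_closed[OF sub that] by (simp add: lattice_group_def)
  have minus: "- x \<in> H" if "x \<in> H" for x
    using subgroup.m_inv_closed[OF sub that] inv_lattice_group[OF N, of x] HN that by auto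
  show diff: "x - y \<in> H" if "x \<in> H" "y \<in> H" for x y
    using add[OF that(1) minus[OF that(2)]] by simp
  have nat: "real n *\<^sub>R x \<in> H" if "x \<in> H" for n x
    using that by (induction n) (auto simp: zero add scaleR_left_distrib)
  show "of_int k *\<^sub>R x \<in> H" if "x \<in> H" for k :: int and x
    using that by (cases k rule: int_cases2) (auto simp: nat minus)
  show "sum f I \<in> H" if "\<And>i. i \<in> I \<Longrightarrow> f i \<in> H" for I :: "'i set" and f
    using that by (induction I rule: infinite_finite_induct) (auto simp: zero add)
qed

text \<open>The map \<open>f\<close> plays the role of the quotient map: its fibres on
  \<open>N\<close> are the cosets of the vertex lattice.\<close>

lemma simplex_mult_eq_card_image:
  assumes N: "is_lattice_basis e N" and V: "vertices P \<subseteq> N"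
    and f: "\<And>x y. x \<in> N \<Longrightarrow> y \<in> N \<Longrightarrow>
      f x = f y \<longleftrightarrow> x - y \<in> generate (lattice_group N) (vertices P)"
  shows "simplex_mult N P = card (f ` N)"
proof -
  let ?H = "generate (lattice_group N) (vertices P)"
  note H = generate_lattice[OF N V]
  have rc: "rcosets\<^bsub>lattice_group N\<^esub> ?H = (\<lambda>x. (\<lambda>h. h + x) ` ?H) ` N"
    by (auto simp: RCOSETS_def r_coset_def lattice_group_def)
  have "(\<lambda>h. h + x) ` ?H = (\<lambda>h. h + y) ` ?H \<longleftrightarrow> x - y \<in> ?H" for x y
  proof
    assume eq: "(\<lambda>h. h + x) ` ?H = (\<lambda>h. h + y) ` ?H"
    have "0 + x \<in> (\<lambda>h. h + x) ` ?H" using H(2) by blast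
    then show "x - y \<in> ?H" unfolding eq by auto
  next
    assume xy: "x - y \<in> ?H"
    have "h + x \<in> (\<lambda>h. h + y) ` ?H" if "h \<in> ?H" for h
      using H(4)[OF that xy] by (intro image_eqI[of _ _ "h + (x - y)"]) auto
    moreover have "h + y \<in> (\<lambda>h. h + x) ` ?H" if "h \<in> ?H" for h
      using H(5)[OF that xy] by (intro image_eqI[of _ _ "h - (x - y)"]) auto
    ultimately show "(\<lambda>h. h + x) ` ?H = (\<lambda>h. h + y) ` ?H" by blast
  qed
  then have "card ((\<lambda>x. (\<lambda>h. h + x) ` ?H) ` N) = card (f ` N)"
    using f by (intro card_image_eq_if_same_kernel) simp
  then show ?thesis by (simp add: simplex_mult_def rc)
qed

lemma simplex_mult_reps:
  assumes N: "is_lattice_basis e N" and V: "vertices P \<subseteq> N" and pos: "simplex_mult N P > 0"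
  obtains R where "finite R" "R \<subseteq> N" "card R = simplex_mult N P"
    "\<And>x y. x \<in> R \<Longrightarrow> y \<in> R \<Longrightarrow> x - y \<in> generate (lattice_group N) (vertices P) \<Longrightarrow> x = y"
proof -
  let ?H = "generate (lattice_group N) (vertices P)"
  define f where "f x = {y. x - y \<in> ?H}" for x
  note H = generate_lattice[OF N V]
  have f: "f x = f y \<longleftrightarrow> x - y \<in> ?H" for x y
  proof
    assume eq: "f x = f y"
    have "y \<in> f y" using H(2) by (simp add: f_def)
    then show "x - y \<in> ?H" unfolding eq[symmetric] by (simp add: f_def)
  next
    assume xy: "x - y \<in> ?H"
    show "f x = f y"
    proof (rule subset_antisym; rule subsetI)
      fix z assume "z \<in> f x"
      then show "z \<in> f y" using H(5)[of "x - z" "x - y"] xy by (simp add: f_def)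
    next
      fix z assume "z \<in> f y"
      then show "z \<in> f x" using H(4)[of "y - z" "x - y"] xy by (simp add: f_def)
    qed
  qed
  have mult: "simplex_mult N P = card (f ` N)"
    by (rule simplex_mult_eq_card_image[OF N V f])
  obtain R where R: "R \<subseteq> N" "inj_on f R" "f ` N = f ` R"
    using subset_image_inj[of "f ` N" f N] by auto
  have "card R = simplex_mult N P" unfolding mult R(3) by (rule card_image[OF R(2), symmetric])
  \<comment> \<open>\<open>card\<close> is 0 on infinite sets, so positive multiplicity yields
    finiteness.\<close>
  moreover have "finite R" using calculation pos card_ge_0_finite by metis
  moreover have "x = y" if "x \<in> R" "y \<in> R" "x - y \<in> ?H" for x y
    using inj_onD[OF R(2)] that f by blast
  ultimately show thesis using that R(1) by blast
qed

text \<open>The vertices generate the same group as the sum \<open>s\<close> of the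
  \<open>u i\<close> together with all \<open>a i *\<^sub>R u i\<close>. Subtracting a multiple of
  \<open>s\<close> removes the last coordinate, and as every \<open>a i\<close> divides
  \<open>a d\<close>, the quotient becomes the product of the cyclic groups of order
  \<open>a i\<close> with \<open>i < d\<close>.\<close>

lemma simplex_mult_diagonal:
  fixes N P :: "(real ^ 'n) set" and a :: "nat \<Rightarrow> nat"
  assumes N: "is_lattice_basis e N"
    and Nu: "N = range (\<lambda>k :: nat \<Rightarrow> int. \<Sum>i=1..d. of_int (k i) *\<^sub>R u i)"
    and g: "\<And>i. linear (g i :: real ^ 'n \<Rightarrow> real)"
      "\<And>i j. i \<in> {1..d} \<Longrightarrow> j \<in> {1..d} \<Longrightarrow> g i (u j) = (if i = j then 1 else 0)"
    and d: "1 \<le> d" and a: "\<And>i. i \<in> {1..d} \<Longrightarrow> 0 < a i \<and> a i dvd a d"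
    and V: "vertices P = insert (- (\<Sum>i=1..d. u i)) ((\<lambda>i. a i *\<^sub>R u i - (\<Sum>i=1..d. u i)) ` {1..d})"
  shows "simplex_mult N P = (\<Prod>i=1..<d. a i)"
proof -
  let ?s = "\<Sum>i=1..d. u i" and ?c = "\<lambda>k :: nat \<Rightarrow> int. \<Sum>i=1..d. of_int (k i) *\<^sub>R u i"
  let ?H = "generate (lattice_group N) (vertices P)"
  \<comment> \<open>On \<open>N\<close> the coordinates are integers, and the floor merely turns
    them into type \<open>int\<close>.\<close>
  define q where "q i x = \<lfloor>g i x\<rfloor>" for i x
  have gc: "g i (?c k) = k i" if "i \<in> {1..d}" for i k
  proof -
    have "g i (?c k) = (\<Sum>j=1..d. if i = j then real_of_int (k j) else 0)"
      unfolding linear_sum[OF g(1)] using that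
      by (intro sum.cong) (auto simp: linear_scale[OF g(1)] g(2))
    then show ?thesis using that by simp
  qed
  have qc: "q i (?c k) = k i" if "i \<in> {1..d}" for i k
    using gc[OF that] by (simp add: q_def)
  have N_iff: "x \<in> N \<longleftrightarrow> (\<exists>k. x = ?c k)" for x unfolding Nu by blast
  have qN: "x = ?c (\<lambda>i. q i x)" if x: "x \<in> N" for x
  proof -
    obtain k where k: "x = ?c k" using x N_iff by blast
    show ?thesis using qc unfolding k by (intro sum.cong) auto
  qed
  have cN: "?c k \<in> N" for k using N_iff by blast
  have lin: "?c k + ?c l = ?c (\<lambda>i. k i + l i)" "?c k - ?c l = ?c (\<lambda>i. k i - l i)" "- ?c k = ?c (\<lambda>i. - k i)" for k l
    by (simp_all add: sum.distrib sum_subtractf sum_negf scaleR_left_distrib scaleR_left_diff_distrib)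
  have q_add: "q i (x + y) = q i x + q i y" and q_diff: "q i (x - y) = q i x - q i y"
    if xy: "x \<in> N" "y \<in> N" and i: "i \<in> {1..d}" for i x y
  proof -
    obtain k l where "x = ?c k" "y = ?c l" using xy N_iff by blast
    then show "q i (x + y) = q i x + q i y" "q i (x - y) = q i x - q i y"
      using i by (simp_all only: lin qc)
  qed
  have q_minus: "q i (- x) = - q i x" if x: "x \<in> N" and i: "i \<in> {1..d}" for i x
  proof -
    obtain k where "x = ?c k" using x N_iff by blast
    then show ?thesis using i by (simp only: lin qc)
  qed
  have s: "?s = ?c (\<lambda>_. 1)" by simp
  have au: "a j *\<^sub>R u j = ?c (\<lambda>i. if i = j then int (a j) else 0)" if "j \<in> {1..d}" for j
    using that by (simp add: if_distrib[of real_of_int] if_distrib[of "\<lambda>x. x *\<^sub>R _"] cong: if_cong)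
  have v0: "- ?s = ?c (\<lambda>_. -1)" by (simp add: sum_negf)
  have vj: "a j *\<^sub>R u j - ?s = ?c (\<lambda>i. (if i = j then int (a j) else 0) - 1)" if "j \<in> {1..d}" for j
    unfolding au[OF that] s lin by simp
  have v0N: "- ?s \<in> N" unfolding v0 by (rule cN)
  have vjN: "a j *\<^sub>R u j - ?s \<in> N" if "j \<in> {1..d}" for j
    unfolding vj[OF that] by (rule cN)
  have VN: "vertices P \<subseteq> N" unfolding V using v0N vjN by blast
  have d_in: "d \<in> {1..d}" using d by simp
  have H_iff: "x \<in> ?H \<longleftrightarrow> (\<forall>i\<in>{1..<d}. int (a i) dvd q i x - q d x)" if x: "x \<in> N" for x
  proof
    assume "x \<in> ?H"
    with N VN show "\<forall>i\<in>{1..<d}. int (a i) dvd q i x - q d x"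
    proof (induction rule: generate_induct)
      case zero
      have "q i 0 = 0" for i by (simp add: q_def linear_0[OF g(1)])
      then show ?case by simp
    next
      case (gen x)
      show ?case
      proof
        fix i assume i: "i \<in> {1..<d}"
        then have i': "i \<in> {1..d}" by simp
        consider "x = - ?s" | j where "j \<in> {1..d}" "x = a j *\<^sub>R u j - ?s" using gen V by auto
        then show "int (a i) dvd q i x - q d x"
        proof cases
          case 1
          show ?thesis unfolding 1 v0 qc[OF i'] qc[OF d_in] by simp
        next
          case 2
          \<comment> \<open>For \<open>j = d\<close> the difference of coordinates is
            \<open>- int (a d)\<close>, a multiple of \<open>a i\<close> by the divisibility
            hypothesis.\<close>
          then show ?thesis unfolding 2(2) vj[OF 2(1)] qc[OF i'] qc[OF d_in]
            using a[OF i'] i by auto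
        qed
      qed
    next
      case (uminus x)
      show ?case
      proof
        fix i assume i: "i \<in> {1..<d}"
        then have i': "i \<in> {1..d}" by simp
        have "x \<in> N" using uminus VN by blast
        then have mq: "q i (- x) - q d (- x) = - (q i x - q d x)"
          using q_minus i' d_in by simp
        consider "x = - ?s" | j where "j \<in> {1..d}" "x = a j *\<^sub>R u j - ?s" using uminus V by auto
        then have "int (a i) dvd q i x - q d x"
        proof cases
          case 1
          show ?thesis unfolding 1 v0 qc[OF i'] qc[OF d_in] by simp
        next
          case 2
          then show ?thesis unfolding 2(2) vj[OF 2(1)] qc[OF i'] qc[OF d_in]
            using a[OF i'] i by auto
        qed
        then show "int (a i) dvd q i (- x) - q d (- x)" unfolding mq by (simp only: dvd_minus_iff)
      qed
    next
      case (add x y)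
      show ?case
      proof
        fix i assume i: "i \<in> {1..<d}"
        then have "q i (x + y) - q d (x + y) = (q i x - q d x) + (q i y - q d y)"
          using q_add add d_in by simp
        then show "int (a i) dvd q i (x + y) - q d (x + y)" using add i by (simp only: dvd_add)
      qed
    qed
  next
    assume dv: "\<forall>i\<in>{1..<d}. int (a i) dvd q i x - q d x"
    note H = generate_lattice[OF N VN]
    have s0: "- ?s \<in> ?H" using H(3) V by blast
    \<comment> \<open>Writing \<open>x\<close> as the sum of the
      \<open>(q i x - q d x) *\<^sub>R u i\<close> plus \<open>q d x\<close> times the sum of all
      \<open>u i\<close> reduces membership to single directions; direction \<open>d\<close>
      contributes zero.\<close>
    have "of_int (q i x - q d x) *\<^sub>R u i \<in> ?H" if i: "i \<in> {1..d}" for i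
    proof (cases "i = d")
      case True
      then show ?thesis using H(2) by simp
    next
      case False
      then obtain t where t: "q i x - q d x = int (a i) * t" using dv i by fastforce
      have "a i *\<^sub>R u i - ?s \<in> ?H" using H(3) V i by blast
      from H(5)[OF this s0] have "a i *\<^sub>R u i \<in> ?H" by simp
      from H(6)[OF this, of t] show ?thesis unfolding t by (simp add: mult.commute)
    qed
    then have "(\<Sum>i=1..d. of_int (q i x - q d x) *\<^sub>R u i) - of_int (q d x) *\<^sub>R (- ?s) \<in> ?H"
      by (rule H(5)[OF H(7) H(6)[OF s0]])
    also have "(\<Sum>i=1..d. of_int (q i x - q d x) *\<^sub>R u i) - of_int (q d x) *\<^sub>R (- ?s) = ?c (\<lambda>i. q i x)"
      by (simp add: sum_subtractf scaleR_left_diff_distrib scaleR_sum_right)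
    finally show "x \<in> ?H" using qN[OF x] by simp
  qed
  define f where "f x = (\<lambda>i\<in>{1..<d}. (q i x - q d x) mod int (a i))" for x
  have "f x = f y \<longleftrightarrow> x - y \<in> ?H" if xy: "x \<in> N" "y \<in> N" for x y
  proof -
    have "f x = f y \<longleftrightarrow> (\<forall>i\<in>{1..<d}. (q i x - q d x) mod int (a i) = (q i y - q d y) mod int (a i))"
      by (auto simp: f_def fun_eq_iff restrict_def)
    also have "\<dots> \<longleftrightarrow> (\<forall>i\<in>{1..<d}. int (a i) dvd q i (x - y) - q d (x - y))"
    proof (intro ball_cong refl)
      fix i assume "i \<in> {1..<d}"
      then have "q i (x - y) - q d (x - y) = (q i x - q d x) - (q i y - q d y)"
        using q_diff[OF xy] d_in by simp
      then show "(q i x - q d x) mod int (a i) = (q i y - q d y) mod int (a i) \<longleftrightarrow>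
          int (a i) dvd q i (x - y) - q d (x - y)"
        by (simp only: mod_eq_dvd_iff)
    qed
    also have "\<dots> \<longleftrightarrow> x - y \<in> ?H" using H_iff[OF diff_in_lattice[OF N xy]] by simp
    finally show ?thesis .
  qed
  then have "simplex_mult N P = card (f ` N)" by (rule simplex_mult_eq_card_image[OF N VN])
  also have "f ` N = PiE {1..<d} (\<lambda>i. {0..<int (a i)})"
  proof (intro subset_antisym subsetI)
    fix t assume "t \<in> f ` N"
    then show "t \<in> PiE {1..<d} (\<lambda>i. {0..<int (a i)})" using a by (auto simp: f_def)
  next
    fix t assume t: "t \<in> PiE {1..<d} (\<lambda>i. {0..<int (a i)})"
    \<comment> \<open>Each tuple of residues is realised by a lattice point with last coordinate
      0.\<close>
    define k where "k i = (if i = d then 0 else t i)" for i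
    have "f (?c k) i = t i" for i
    proof (cases "i \<in> {1..<d}")
      case True
      then have "i \<in> {1..d}" by simp
      then show ?thesis using True PiE_mem[OF t True] qc[of i k] qc[OF d_in, of k]
        by (simp add: f_def k_def)
    next
      case False
      then show ?thesis using PiE_arb[OF t False] False unfolding f_def restrict_def by (simp only: if_False)
    qed
    then show "t \<in> f ` N" using cN by (intro image_eqI[of _ _ "?c k"]) auto
  qed
  also have "card \<dots> = (\<Prod>i=1..<d. a i)" by (simp add: card_PiE)
  finally show ?thesis .
qed

section \<open>Canonical lattice simplices\<close>

lemma canonical_simplex_vertices:
  fixes P :: "(real ^ 'n) set"
  assumes "canonical_lattice_simplex N P"
  shows "finite (vertices P)" "card (vertices P) = CARD('n) + 1"
    "\<not> affine_dependent (vertices P)" "P = convex hull (vertices P)"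
proof -
  obtain C where C: "finite C" "\<not> affine_dependent C" "int (card C) = int CARD('n) + 1" "P = convex hull C"
    using assms unfolding canonical_lattice_simplex_def simplex by blast
  have "vertices P = C"
    using extreme_point_of_convex_hull_affine_independent[OF C(2)] unfolding vertices_def C(4) by blast
  then show "finite (vertices P)" "card (vertices P) = CARD('n) + 1"
    "\<not> affine_dependent (vertices P)" "P = convex hull (vertices P)"
    using C by auto
qed

text \<open>The weights \<open>b\<close> are the barycentric coordinates of the origin, all positive
  because it is interior. Sorting the vertices by weight provides the ordering that the estimates
  rely on.\<close>

lemma canonical_frame_exists:
  fixes N P :: "(real ^ 'n) set"
  assumes N: "is_lattice_basis e N" and P: "canonical_lattice_simplex N P"
  obtains v c b where "canonical_frame N (\<lambda>i. v i - v 0) c b CARD('n)"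
    "vertices P = v ` {0..CARD('n)}" "v 0 = - (\<Sum>i=1..CARD('n). b i *\<^sub>R (v i - v 0))"
    "\<forall>i j. 1 \<le> i \<and> i \<le> j \<and> j \<le> CARD('n) \<longrightarrow> b j \<le> b i" "\<forall>i\<in>{1..CARD('n)}. b 0 \<le> b i"
proof -
  let ?d = "CARD('n)" and ?C = "vertices P"
  note C = canonical_simplex_vertices[OF P]
  have CN: "?C \<subseteq> N" and int: "interior P \<inter> N = {0}"
    using P by (auto simp: canonical_lattice_simplex_def)
  have "0 \<in> interior (convex hull ?C)" using int C(4) by auto
  then obtain \<beta> where \<beta>: "\<forall>x\<in>?C. 0 < \<beta> x" "sum \<beta> ?C = 1" "(\<Sum>x\<in>?C. \<beta> x *\<^sub>R x) = 0"
    using C(2,3) by (auto simp: interior_convex_hull_explicit_minimal)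
  obtain ys where ys: "set ys = ?C" "distinct ys" using finite_distinct_list[OF C(1)] by blast
  define xs where "xs = sort_key (\<lambda>x. - \<beta> x) ys"
  have xs: "set xs = ?C" "distinct xs" "length xs = ?d + 1" and sorted: "sorted (map (\<lambda>x. - \<beta> x) xs)"
    using ys C(2) distinct_card[OF ys(2)] by (auto simp: xs_def)
  \<comment> \<open>The list is in order of decreasing weight; its last entry, of least weight,
    becomes \<open>v 0\<close>, and the others keep their order as
    \<open>v 1, ..., v d\<close>.\<close>
  define v where "v i = xs ! (if i = 0 then ?d else i - 1)" for i
  define b where "b i = \<beta> (v i)" for i
  have v_inj: "inj_on v {0..?d}"
    using xs by (auto simp: inj_on_def v_def nth_eq_iff_index_eq split: if_splits)
  have "card (v ` {0..?d}) = card ?C" using C(2) v_inj by (simp add: card_image)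
  moreover have sub: "v ` {0..?d} \<subseteq> ?C" using xs by (auto simp: v_def simp flip: xs(1) intro!: nth_mem)
  ultimately have vC: "?C = v ` {0..?d}" using card_subset_eq[OF C(1)] by metis
  have aff: "\<not> affine_dependent (v ` {0..?d})" using C(3) vC by simp
  have b_pos: "0 < b i" if "i \<le> ?d" for i
  proof -
    have "v i \<in> v ` {0..?d}" using that by simp
    then show ?thesis using \<beta>(1) sub unfolding b_def by blast
  qed
  have b_sum: "b 0 + (\<Sum>i=1..?d. b i) = 1"
    using \<beta>(2) unfolding vC sum.reindex[OF v_inj] by (simp add: b_def sum_atLeast0_atMost_split)
  have b_bary: "b 0 *\<^sub>R v 0 + (\<Sum>i=1..?d. b i *\<^sub>R v i) = 0"
    using \<beta>(3) unfolding vC sum.reindex[OF v_inj] by (simp add: b_def sum_atLeast0_atMost_split)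
  have vN: "v i \<in> N" if "i \<le> ?d" for i
  proof -
    have "v i \<in> v ` {0..?d}" using that by simp
    then show ?thesis using sub CN by blast
  qed
  define w where "w i = v i - v 0" for i
  have w_inj: "inj_on w {1..?d}" using v_inj by (auto simp: w_def inj_on_def)
  have v0_notin: "v 0 \<notin> v ` {1..?d}" using inj_onD[OF v_inj, of 0] by fastforce
  have ins: "v ` {0..?d} = insert (v 0) (v ` {1..?d})"
    by (metis One_nat_def atLeastAtMost_insertL image_insert zero_le)
  have "independent ((+) (- v 0) ` v ` {1..?d})"
    using aff unfolding ins affine_dependent_iff_dependent[OF v0_notin] .
  moreover have "(+) (- v 0) ` v ` {1..?d} = w ` {1..?d}" by (simp add: image_image w_def)
  ultimately have w_ind: "independent (w ` {1..?d})" by simp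
  obtain c where c: "\<And>i. linear (c i)"
    "\<And>i j. i \<in> {1..?d} \<Longrightarrow> j \<in> {1..?d} \<Longrightarrow> c i (w j) = (if i = j then 1 else 0 :: real)"
    "\<And>x. x = (\<Sum>i=1..?d. c i x *\<^sub>R w i)"
    using dual_family[OF w_inj w_ind] by blast
  have comb: "(1 - (\<Sum>i=1..?d. k i)) *\<^sub>R v 0 + (\<Sum>i=1..?d. k i *\<^sub>R v i) = v 0 + (\<Sum>i=1..?d. k i *\<^sub>R w i)" for k
    by (simp add: w_def scaleR_right_diff_distrib sum_subtractf scaleR_left_diff_distrib scaleR_left.sum)
  have b0: "b 0 = 1 - (\<Sum>i=1..?d. b i)" using b_sum by simp
  have v0: "v 0 + (\<Sum>i=1..?d. b i *\<^sub>R w i) = 0"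
    using b_bary comb[of b] unfolding b0 by simp
  then have v0': "v 0 = - (\<Sum>i=1..?d. b i *\<^sub>R w i)" by (simp add: eq_neg_iff_add_eq_0)
  have frame: "canonical_frame N w c b ?d"
  proof (rule canonical_frame.intro)
    show "0 \<in> N" by (rule zero_in_lattice[OF N])
    show "x - y \<in> N" if "x \<in> N" "y \<in> N" for x y using diff_in_lattice[OF N that] .
    show "linear (c i)" for i by (rule c(1))
    show "y = (\<Sum>i=1..?d. c i y *\<^sub>R w i)" for y by (rule c(3))
    show "w i \<in> N" if "i \<in> {1..?d}" for i
      unfolding w_def using that by (intro diff_in_lattice[OF N] vN) auto
    show "(\<Sum>i=1..?d. b i *\<^sub>R w i) \<in> N"
      using uminus_in_lattice[OF N vN[of 0]] unfolding v0' by simp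
    fix x assume x: "x \<in> N" "\<And>i. i \<in> {1..?d} \<Longrightarrow> - b i < c i x" "(\<Sum>i=1..?d. c i x) < b 0"
    \<comment> \<open>These are the barycentric coordinates of \<open>x\<close>: those of the origin
      shifted by the edge coordinates of \<open>x\<close>.\<close>
    define u where "u i = (if i = 0 then b 0 - (\<Sum>i=1..?d. c i x) else b i + c i x)" for i
    have "(\<Sum>i=1..?d. u i) = (\<Sum>i=1..?d. b i) + (\<Sum>i=1..?d. c i x)"
      by (simp add: u_def sum.distrib)
    then have u0: "u 0 = 1 - (\<Sum>i=1..?d. u i)" using b0 by (simp add: u_def)
    have "(\<Sum>i=0..?d. u i *\<^sub>R v i) = v 0 + (\<Sum>i=1..?d. u i *\<^sub>R w i)"
      unfolding sum_atLeast0_atMost_split u0 comb by simp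
    also have "(\<Sum>i=1..?d. u i *\<^sub>R w i) = (\<Sum>i=1..?d. b i *\<^sub>R w i) + (\<Sum>i=1..?d. c i x *\<^sub>R w i)"
      by (simp add: u_def scaleR_left_distrib sum.distrib)
    also have "v 0 + \<dots> = x" using v0 c(3)[of x] by (simp add: add.assoc[symmetric])
    finally have "(\<Sum>i=0..?d. u i *\<^sub>R v i) = x" .
    moreover have "sum u {0..?d} = 1" unfolding sum_atLeast0_atMost_split using u0 by simp
    moreover have "\<forall>i\<in>{0..?d}. 0 < u i"
    proof
      fix i assume "i \<in> {0..?d}"
      then show "0 < u i" using x(2)[of i] x(3) by (cases "i = 0") (auto simp: u_def)
    qed
    ultimately have "x \<in> interior (convex hull (v ` {0..?d}))"
      unfolding interior_simplex_explicit[OF v_inj aff] by blast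
    then show "x = 0" using int x(1) C(4) unfolding vC by blast
  qed (use c(2) b_pos b_sum in auto)
  have mono: "\<beta> (xs ! j) \<le> \<beta> (xs ! i)" if "i \<le> j" "j < length xs" for i j
    using sorted_nth_mono[OF sorted, of i j] that by simp
  show thesis
  proof (rule that)
    show "canonical_frame N (\<lambda>i. v i - v 0) c b ?d" using frame unfolding w_def .
    show "?C = v ` {0..?d}" by (rule vC)
    show "v 0 = - (\<Sum>i=1..?d. b i *\<^sub>R (v i - v 0))" using v0' unfolding w_def .
    show "\<forall>i j. 1 \<le> i \<and> i \<le> j \<and> j \<le> ?d \<longrightarrow> b j \<le> b i"
      using xs(3) by (auto simp: b_def v_def diff_le_mono intro!: mono)
    show "\<forall>i\<in>{1..?d}. b 0 \<le> b i"
      using xs(3) by (auto simp: b_def v_def intro!: mono)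
  qed
qed

section \<open>The model simplices and their multiplicity\<close>

text \<open>A common form of both extremal simplices: \<open>a\<close> is constantly
  \<open>d + 1\<close> for \<open>d \<le> 3\<close>, and \<open>(2, 8, 8, 8)\<close> for
  \<open>d = 4\<close>.\<close>

definition model_simplex :: "(nat \<Rightarrow> real ^ 'n) \<Rightarrow> (nat \<Rightarrow> nat) \<Rightarrow> (real ^ 'n) set" where
  "model_simplex e a = (\<lambda>x. x - (\<Sum>i=1..CARD('n). e i)) `
     (convex hull (insert 0 ((\<lambda>i. real (a i) *\<^sub>R e i) ` {1..CARD('n)})))"

definition model_vertex :: "(nat \<Rightarrow> real ^ 'n) \<Rightarrow> (nat \<Rightarrow> nat) \<Rightarrow> nat \<Rightarrow> real ^ 'n" where
  "model_vertex e a i = (if i = 0 then 0 else real (a i) *\<^sub>R e i) - (\<Sum>i=1..CARD('n). e i)"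

lemma model_simplex_eq:
  fixes e :: "nat \<Rightarrow> real ^ 'n"
  shows "model_simplex e a = convex hull (model_vertex e a ` {0..CARD('n)})"
proof -
  let ?s = "\<Sum>i=1..CARD('n). e i"
  have *: "{0..CARD('n)} = insert 0 {1..CARD('n)}" by auto
  have "model_vertex e a ` {0..CARD('n)} =
      (+) (- ?s) ` (insert 0 ((\<lambda>i. real (a i) *\<^sub>R e i) ` {1..CARD('n)}))"
    unfolding * by (auto simp: model_vertex_def image_iff)
  moreover have "(\<lambda>x. x - ?s) = (+) (- ?s)" by auto
  ultimately show ?thesis by (simp only: model_simplex_def convex_hull_translation)
qed

text \<open>The linear map taking \<open>b i *\<^sub>R w i\<close> to \<open>e i\<close>, where
  \<open>w i = v i - v 0\<close>, carries one lattice basis to another and so preserves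
  \<open>N\<close>. It sends \<open>v 0\<close> to minus the sum of the \<open>e i\<close> and
  \<open>w i\<close> to \<open>a i *\<^sub>R e i\<close>; the translation is 0.\<close>

lemma unimodular_equiv_model:
  fixes N P :: "(real ^ 'n) set"
  assumes N: "is_lattice_basis e N" and frame: "canonical_frame N (\<lambda>i. v i - v 0) c b CARD('n)"
    and P: "P = convex hull (v ` {0..CARD('n)})"
    and v0: "v 0 = - (\<Sum>i=1..CARD('n). b i *\<^sub>R (v i - v 0))"
    and a: "\<And>i. i \<in> {1..CARD('n)} \<Longrightarrow> b i = 1 / real (a i)"
    and Nu: "N = range (\<lambda>k :: nat \<Rightarrow> int. \<Sum>i=1..CARD('n). of_int (k i) *\<^sub>R (b i *\<^sub>R (v i - v 0)))"
  shows "unimodular_equiv N P (model_simplex e a)"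
proof -
  let ?d = "CARD('n)"
  interpret canonical_frame N "\<lambda>i. v i - v 0" c b "CARD('n)" by (rule frame)
  define A where "A x = (\<Sum>i=1..?d. (c i x / b i) *\<^sub>R e i)" for x
  have linA: "linear A"
    unfolding A_def
    by (intro linear_compose_sum ballI linearI)
      (simp_all add: linear_add[OF linear_c] linear_scale[OF linear_c] scaleR_left_distrib add_divide_distrib)
  have A_sum: "A (\<Sum>i=1..?d. k i *\<^sub>R (b i *\<^sub>R (v i - v 0))) = (\<Sum>i=1..?d. k i *\<^sub>R e i)" for k
  proof -
    have "c i (\<Sum>i=1..?d. k i *\<^sub>R (b i *\<^sub>R (v i - v 0))) / b i = k i" if "i \<in> {1..?d}" for i
      using c_sum[OF that, of "\<lambda>i. k i * b i"] b_pos[of i] that by simp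
    then show ?thesis unfolding A_def by (intro sum.cong) auto
  qed
  have Ne: "N = range (\<lambda>k :: nat \<Rightarrow> int. \<Sum>i=1..?d. of_int (k i) *\<^sub>R e i)"
    and e: "inj_on e {1..?d}" "independent (e ` {1..?d})"
    using N by (auto simp: is_lattice_basis_def)
  have "A ` N = N"
    by (subst Nu, subst Ne) (simp only: image_image A_sum)
  moreover have "inj A"
  proof (rule injI)
    fix x y assume "A x = A y"
    obtain g where g: "\<And>i. linear (g i)"
      "\<And>i j. i \<in> {1..?d} \<Longrightarrow> j \<in> {1..?d} \<Longrightarrow> g i (e j) = (if i = j then 1 else 0 :: real)"
      by (rule dual_family[OF e]) blast
    have gA: "g i (A z) = c i z / b i" if "i \<in> {1..?d}" for i z
    proof -
      have "g i (A z) = (\<Sum>j=1..?d. if i = j then c j z / b j else 0)"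
        unfolding A_def linear_sum[OF g(1)] using that
        by (intro sum.cong) (auto simp: linear_scale[OF g(1)] g(2))
      then show ?thesis using that by simp
    qed
    have "c i x = c i y" if "i \<in> {1..?d}" for i
      using gA[OF that, of x] gA[OF that, of y] \<open>A x = A y\<close> b_pos[of i] that by auto
    then have "x - y = 0" by (intro eq_zero_if_coords) (simp add: c_simps)
    then show "x = y" by simp
  qed
  ultimately have bij: "bij_betw A N N" by (auto simp: bij_betw_def inj_on_def)
  have Av: "A (v i) = model_vertex e a i" if "i \<in> {0..?d}" for i
  proof -
    have A0: "A (v 0) = - (\<Sum>i=1..?d. e i)"
    proof -
      have "v 0 = - (\<Sum>i=1..?d. 1 *\<^sub>R (b i *\<^sub>R (v i - v 0)))"
        using v0 by (simp only: scaleR_one)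
      then have "A (v 0) = A (- (\<Sum>i=1..?d. 1 *\<^sub>R (b i *\<^sub>R (v i - v 0))))" by (rule arg_cong)
      then show ?thesis unfolding linear_neg[OF linA] A_sum by (simp only: scaleR_one)
    qed
    show ?thesis
    proof (cases "i = 0")
      case True
      then show ?thesis using A0 by (simp add: model_vertex_def)
    next
      case False
      then have i: "i \<in> {1..?d}" using that by auto
      have "A (v i - v 0) = (\<Sum>j=1..?d. if j = i then (1 / b i) *\<^sub>R e i else 0)"
        unfolding A_def using i by (intro sum.cong) (auto simp: c_w)
      then have "A (v i - v 0) = (1 / b i) *\<^sub>R e i" using i by simp
      then show ?thesis
        using A0 a[OF i] False by (simp add: linear_diff[OF linA] model_vertex_def algebra_simps)
    qed
  qed
  have "A ` v ` {0..?d} = model_vertex e a ` {0..?d}"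
    unfolding image_image by (rule image_cong[OF refl Av])
  then have "A ` P = model_simplex e a"
    by (simp only: P model_simplex_eq convex_hull_linear_image[OF linA])
  then show ?thesis
    unfolding unimodular_equiv_def using linA zero_in bij by (intro exI[of _ A] exI[of _ 0]) simp
qed

text \<open>Pulling the model back along the equivalence puts the vertices of \<open>P\<close> into
  the diagonal form of \<open>simplex_mult_diagonal\<close>, with basis \<open>B (e i)\<close>, once
  the translation \<open>w\<close> is known to vanish. The origin is an interior lattice point of
  the model, so its preimage is one of \<open>P\<close> and equals 0.\<close>

lemma simplex_mult_model:
  fixes N P :: "(real ^ 'n) set" and a :: "nat \<Rightarrow> nat"
  assumes N: "is_lattice_basis e N" and P: "canonical_lattice_simplex N P"
    and equiv: "unimodular_equiv N P (model_simplex e a)"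
    and a: "\<And>i. i \<in> {1..CARD('n)} \<Longrightarrow> 0 < a i \<and> a i dvd a CARD('n)"
    and a_sum: "(\<Sum>i=1..CARD('n). 1 / real (a i)) < 1"
  shows "simplex_mult N P = (\<Prod>i=1..<CARD('n). a i)"
proof -
  let ?d = "CARD('n)" and ?q = "model_vertex e a"
  obtain A w where A: "linear A" "bij_betw A N N" "w \<in> N" "model_simplex e a = (\<lambda>x. A x + w) ` P"
    using equiv by (auto simp: unimodular_equiv_def)
  have Ne: "N = range (\<lambda>k :: nat \<Rightarrow> int. \<Sum>i=1..?d. of_int (k i) *\<^sub>R e i)"
    and e: "inj_on e {1..?d}" "independent (e ` {1..?d})"
    using N by (auto simp: is_lattice_basis_def)
  obtain g where g: "\<And>i. linear (g i)"
    "\<And>i j. i \<in> {1..?d} \<Longrightarrow> j \<in> {1..?d} \<Longrightarrow> g i (e j) = (if i = j then 1 else 0 :: real)"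
    "\<And>x. x = (\<Sum>i=1..?d. g i x *\<^sub>R e i)"
    using dual_family[OF e] by blast
  have AN: "A ` N = N" using A(2) by (simp add: bij_betw_def)
  have eN: "e j \<in> N" if "j \<in> {1..?d}" for j
    unfolding Ne using that
    by (intro range_eqI[of _ _ "\<lambda>i. if i = j then 1 else 0"])
      (simp add: if_distrib[of real_of_int] if_distrib[of "\<lambda>x. x *\<^sub>R _"] cong: if_cong)
  \<comment> \<open>The image of \<open>A\<close> contains the basis vectors \<open>e j\<close>,
    hence the whole space.\<close>
  have "\<exists>y. A y = x" for x
  proof -
    have "\<forall>j\<in>{1..?d}. \<exists>y. A y = e j" using eN AN by (metis imageE)
    then obtain y where y: "\<And>j. j \<in> {1..?d} \<Longrightarrow> A (y j) = e j" by metis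
    have "A (\<Sum>i=1..?d. g i x *\<^sub>R y i) = x"
      unfolding linear_sum[OF A(1)] by (subst (2) g(3)[of x]) (simp add: linear_scale[OF A(1)] y)
    then show ?thesis by blast
  qed
  then have "surj A" by (metis surj_def)
  then have "inj A" using linear_surjective_imp_injective[OF A(1)] by simp
  obtain B where B: "linear B" "B \<circ> A = id"
    using linear_injective_left_inverse[OF A(1) \<open>inj A\<close>] by blast
  have BA: "B (A x) = x" for x using B(2) by (metis comp_apply id_apply)
  have AB: "A (B x) = x" for x using \<open>surj A\<close> BA by (metis surj_def)
  have BN: "B ` N = N" using AN BA by (metis (no_types, lifting) image_cong image_ident image_image)
  define p where "p i = B (?q i - w)" for i
  have P_p: "P = convex hull (p ` {0..?d})"
  proof -
    have "P = (\<lambda>x. B (x - w)) ` model_simplex e a" unfolding A(4) image_image using BA by simp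
    also have "\<dots> = B ` (+) (- w) ` model_simplex e a" by (simp add: image_image)
    also have "\<dots> = convex hull (B ` (+) (- w) ` ?q ` {0..?d})"
      unfolding model_simplex_eq by (simp only: convex_hull_translation[symmetric] convex_hull_linear_image[OF B(1)])
    also have "B ` (+) (- w) ` ?q ` {0..?d} = p ` {0..?d}" by (simp add: image_image p_def)
    finally show ?thesis .
  qed
  note C = canonical_simplex_vertices[OF P]
  \<comment> \<open>\<open>P\<close> has \<open>d + 1\<close> vertices, all among the
    \<open>d + 1\<close> points \<open>p i\<close>; hence these are exactly the vertices and are
    distinct.\<close>
  have "vertices P \<subseteq> p ` {0..?d}"
    unfolding vertices_def P_p using extreme_point_of_convex_hull by blast
  moreover have "card (p ` {0..?d}) \<le> card (vertices P)"
    using card_image_le[of "{0..?d}" p] C(2) by simp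
  ultimately have V: "vertices P = p ` {0..?d}" by (simp add: card_seteq)
  have p: "inj_on p {0..?d}" "\<not> affine_dependent (p ` {0..?d})"
    using C(2,3) V by (auto intro: eq_card_imp_inj_on)
  \<comment> \<open>Barycentric coordinates of the origin in the model; \<open>a_sum\<close> makes
    the one at index 0 positive.\<close>
  define \<beta> where "\<beta> i = (if i = 0 then 1 - (\<Sum>i=1..?d. 1 / real (a i)) else 1 / real (a i))" for i
  have \<beta>_sum: "sum \<beta> {0..?d} = 1" unfolding sum_atLeast0_atMost_split by (simp add: \<beta>_def)
  moreover have "\<forall>i\<in>{0..?d}. 0 < \<beta> i" using a a_sum by (auto simp: \<beta>_def)
  ultimately have "(\<Sum>i=0..?d. \<beta> i *\<^sub>R p i) \<in> interior P"
    unfolding P_p interior_simplex_explicit[OF p] by (intro exI[of _ \<beta>] conjI refl)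
  also have "(\<Sum>i=0..?d. \<beta> i *\<^sub>R p i) = B ((\<Sum>i=0..?d. \<beta> i *\<^sub>R ?q i) - w)"
    using \<beta>_sum by (simp add: p_def linear_diff[OF B(1)] linear_sum[OF B(1)] linear_scale[OF B(1)]
      scaleR_right_diff_distrib sum_subtractf scaleR_left.sum[symmetric])
  also have "(\<Sum>i=0..?d. \<beta> i *\<^sub>R ?q i) = 0"
  proof -
    have "(\<Sum>i=1..?d. \<beta> i *\<^sub>R (if i = 0 then 0 else real (a i) *\<^sub>R e i)) = (\<Sum>i=1..?d. e i)"
    proof (rule sum.cong)
      fix i assume "i \<in> {1..?d}"
      then show "\<beta> i *\<^sub>R (if i = 0 then 0 else real (a i) *\<^sub>R e i) = e i"
        using a[of i] by (auto simp: \<beta>_def)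
    qed simp
    then have "(\<Sum>i=0..?d. \<beta> i *\<^sub>R (if i = 0 then 0 else real (a i) *\<^sub>R e i)) = (\<Sum>i=1..?d. e i)"
      unfolding sum_atLeast0_atMost_split by simp
    then show ?thesis
      using \<beta>_sum by (simp add: model_vertex_def scaleR_right_diff_distrib sum_subtractf scaleR_left.sum[symmetric])
  qed
  finally have "B (0 - w) \<in> interior P" .
  moreover have "B (0 - w) \<in> N" using BN uminus_in_lattice[OF N A(3)] by (metis diff_0 imageI)
  ultimately have "B (0 - w) = 0" using P by (auto simp: canonical_lattice_simplex_def)
  then have w: "w = 0" using AB[of "0 - w"] linear_0[OF A(1)] by simp
  show ?thesis
  proof (rule simplex_mult_diagonal[OF N])
    show "N = range (\<lambda>k :: nat \<Rightarrow> int. \<Sum>i=1..?d. of_int (k i) *\<^sub>R B (e i))"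
      by (subst BN[symmetric], subst Ne)
        (simp only: image_image linear_sum[OF B(1)] linear_scale[OF B(1)])
    show "linear (g i \<circ> A)" for i by (rule linear_compose[OF A(1) g(1)])
    show "(g i \<circ> A) (B (e j)) = (if i = j then 1 else 0)" if "i \<in> {1..?d}" "j \<in> {1..?d}" for i j
      using g(2)[OF that] by (simp add: AB)
    have "{0..?d} = insert 0 {1..?d}" by auto
    then show "vertices P = insert (- (\<Sum>i=1..?d. B (e i)))
        ((\<lambda>i. real (a i) *\<^sub>R B (e i) - (\<Sum>i=1..?d. B (e i))) ` {1..?d})"
      unfolding V p_def model_vertex_def w
      by (auto simp: linear_diff[OF B(1)] linear_sum[OF B(1)] linear_scale[OF B(1)] linear_neg[OF B(1)]
        linear_0[OF B(1)] image_iff)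
  qed (use a in \<open>auto simp: Suc_le_eq\<close>)
qed

section \<open>From the multiplicity to the weight inequality\<close>

text \<open>Each class modulo the vertex lattice contributes at least \<open>1 / b 0\<close> classes
  modulo the edge lattice, and the packing bound limits their number. The representatives themselves
  are passed on, since the equality case depends on their exact count.\<close>

lemma simplex_mult_le_weights:
  fixes N P :: "(real ^ 'n) set"
  assumes N: "is_lattice_basis e N" and P: "canonical_lattice_simplex N P"
  obtains v c b where "canonical_frame N (\<lambda>i. v i - v 0) c b CARD('n)"
    "P = convex hull (v ` {0..CARD('n)})" "v 0 = - (\<Sum>i=1..CARD('n). b i *\<^sub>R (v i - v 0))"
    "\<forall>i j. 1 \<le> i \<and> i \<le> j \<and> j \<le> CARD('n) \<longrightarrow> b j \<le> b i" "\<forall>i\<in>{1..CARD('n)}. b 0 \<le> b i"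
    "real (simplex_mult N P) * (\<Prod>i=1..CARD('n). b i) \<le> b 0"
    "simplex_mult N P > 0 \<longrightarrow> (\<exists>F. canonical_frame.reps_mod_edges N (\<lambda>i. v i - v 0) CARD('n) F \<and>
      card F = simplex_mult N P * nat \<lceil>1 / b 0\<rceil>)"
proof -
  let ?d = "CARD('n)"
  obtain v c b where frame: "canonical_frame N (\<lambda>i. v i - v 0) c b ?d"
    and V: "vertices P = v ` {0..?d}" and v0: "v 0 = - (\<Sum>i=1..?d. b i *\<^sub>R (v i - v 0))"
    and dec: "\<forall>i j. 1 \<le> i \<and> i \<le> j \<and> j \<le> ?d \<longrightarrow> b j \<le> b i" "\<forall>i\<in>{1..?d}. b 0 \<le> b i"
    by (rule canonical_frame_exists[OF N P]) (rule that)
  interpret canonical_frame N "\<lambda>i. v i - v 0" c b "CARD('n)" by (rule frame)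
  have VN: "vertices P \<subseteq> N" using P by (simp add: canonical_lattice_simplex_def)
  have ex: "\<exists>F. reps_mod_edges F \<and> card F = simplex_mult N P * nat \<lceil>1 / b 0\<rceil>" if pos: "simplex_mult N P > 0"
  proof -
    obtain R where R: "finite R" "R \<subseteq> N" "card R = simplex_mult N P"
      "\<And>x y. x \<in> R \<Longrightarrow> y \<in> R \<Longrightarrow> x - y \<in> generate (lattice_group N) (vertices P) \<Longrightarrow> x = y"
      using simplex_mult_reps[OF N VN pos] by blast
    note H = generate_lattice[OF N VN]
    have vH: "v i \<in> generate (lattice_group N) (vertices P)" if "i \<le> ?d" for i
      using H(3) V that by auto
    have apexH: "apex \<in> generate (lattice_group N) (vertices P)"
    proof -
      have "apex = 0 - v 0" using arg_cong[OF v0, of uminus] by (simp only: minus_minus diff_0)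
      then show ?thesis using H(5)[OF H(2) vH[of 0]] by simp
    qed
    obtain F where "reps_mod_edges F" "card F = card R * nat \<lceil>1 / b 0\<rceil>"
    proof (rule refine_reps[OF R(1,2) H(4) _ _ R(4)])
      show "(\<Sum>i=1..?d. of_int (z i) *\<^sub>R (v i - v 0)) \<in> generate (lattice_group N) (vertices P)" for z :: "nat \<Rightarrow> int"
        by (intro H(7) H(6) H(5) vH) auto
      show "of_int k *\<^sub>R apex \<in> generate (lattice_group N) (vertices P)" for k
        by (rule H(6)[OF apexH])
    qed auto
    then show ?thesis using R(3) by auto
  qed
  have bound: "real (simplex_mult N P) * (\<Prod>i=1..?d. b i) \<le> b 0"
  proof (cases "simplex_mult N P > 0")
    case True
    then obtain F where F: "reps_mod_edges F" "card F = simplex_mult N P * nat \<lceil>1 / b 0\<rceil>"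
      using ex by blast
    have b0: "0 < b 0" using b_pos by simp
    have prod: "0 \<le> (\<Prod>i=1..?d. b i)" using b_pos by (intro prod_nonneg) (auto intro: less_imp_le)
    have "1 / b 0 \<le> real (nat \<lceil>1 / b 0\<rceil>)" by linarith
    then have "(real (simplex_mult N P) * (\<Prod>i=1..?d. b i)) * (1 / b 0) \<le>
        (real (simplex_mult N P) * (\<Prod>i=1..?d. b i)) * real (nat \<lceil>1 / b 0\<rceil>)"
      using prod by (intro mult_left_mono) auto
    also have "\<dots> = real (card F) * (\<Prod>i=1..?d. b i)" unfolding F(2) by simp
    also have "\<dots> \<le> 1" by (rule card_reps_mod_edges[OF F(1)])
    finally show ?thesis using b0 by (simp add: field_simps)
  next
    \<comment> \<open>Multiplicity 0, which would also be the value of \<open>card\<close> for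
      infinitely many cosets, satisfies the inequality trivially.\<close>
    case False
    then show ?thesis using b_pos[of 0] by simp
  qed
  have "P = convex hull (v ` {0..?d})" using canonical_simplex_vertices(4)[OF P] V by simp
  then show thesis using ex by (intro that[OF frame _ v0 dec bound]) auto
qed

section \<open>Sharp multiplicity bounds and their equality cases\<close>

theorem proposition2p8:
  fixes N P :: "(real ^ 'n) set" and e :: "nat \<Rightarrow> real ^ 'n" and d :: nat
  assumes "d = CARD('n)"
    and "is_lattice_basis e N"
    and "canonical_lattice_simplex N P"
  shows "(d \<le> 3 \<longrightarrow>
            simplex_mult N P \<le> (d + 1) ^ (d - 1) \<and>
            (simplex_mult N P = (d + 1) ^ (d - 1) \<longleftrightarrow>
               unimodular_equiv N P
                 ((\<lambda>x. x - (\<Sum>i=1..d. e i)) `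
                    (convex hull (insert 0 ((\<lambda>i. real (d + 1) *\<^sub>R e i) ` {1..d})))))) \<and>
         (d = 4 \<longrightarrow>
            simplex_mult N P \<le> 128 \<and>
            (simplex_mult N P = 128 \<longleftrightarrow>
               unimodular_equiv N P
                 ((\<lambda>x. x - (e 1 + e 2 + e 3 + e 4)) `
                    (convex hull {0, 2 *\<^sub>R e 1, 8 *\<^sub>R e 2, 8 *\<^sub>R e 3, 8 *\<^sub>R e 4}))))"
proof (intro conjI impI)
  note d = assms(1) and N = assms(2) and P = assms(3)
  let ?m = "simplex_mult N P"
  obtain v c b where frame: "canonical_frame N (\<lambda>i. v i - v 0) c b CARD('n)"
    and hull: "P = convex hull (v ` {0..CARD('n)})"
    and v0: "v 0 = - (\<Sum>i=1..CARD('n). b i *\<^sub>R (v i - v 0))"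
    and dec: "\<forall>i j. 1 \<le> i \<and> i \<le> j \<and> j \<le> CARD('n) \<longrightarrow> b j \<le> b i"
      "\<forall>i\<in>{1..CARD('n)}. b 0 \<le> b i"
    and m: "real ?m * (\<Prod>i=1..CARD('n). b i) \<le> b 0"
    and ex: "?m > 0 \<longrightarrow> (\<exists>F. canonical_frame.reps_mod_edges N (\<lambda>i. v i - v 0) CARD('n) F \<and>
      card F = ?m * nat \<lceil>1 / b 0\<rceil>)"
    by (rule simplex_mult_le_weights[OF N P]) (rule that)
  interpret canonical_frame N "\<lambda>i. v i - v 0" c b "CARD('n)" by (rule frame)
  have d1: "1 \<le> CARD('n)" by (simp add: Suc_le_eq)
  have dec1: "b j \<le> b i" if "1 \<le> i" "i \<le> j" "j \<le> CARD('n)" for i j using dec(1) that by blast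
  have dec2: "b 0 \<le> b i" if "i \<in> {1..CARD('n)}" for i using dec(2) that by blast
  note W = mult_le_of_weights[OF dec1 dec2 d1 of_nat_0_le_iff m]
  \<comment> \<open>The equality cases of both dimension ranges share this argument; direction 1 is
    the only one whose weight may differ from \<open>b 0\<close>.\<close>
  have equiv: "unimodular_equiv N P (model_simplex e a)"
    if pos: "?m > 0" and a: "\<And>i. i \<in> {1..CARD('n)} \<Longrightarrow> b i = 1 / real (a i)"
      and b0: "b 0 = 1 / real a0"
      and card: "?m * a0 = (\<Prod>i=1..CARD('n). a i)"
      and rest: "\<And>i. i \<in> {1..CARD('n)} \<Longrightarrow> i \<noteq> 1 \<Longrightarrow> b i = b 0" for a a0
  proof -
    obtain F where F: "reps_mod_edges F" "card F = ?m * nat \<lceil>1 / b 0\<rceil>" using ex pos by blast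
    \<comment> \<open>As \<open>b 0 = 1 / a0\<close>, the ceiling is exactly \<open>a0\<close>, and
      the number of representatives is the reciprocal of the box volume: the boxes tile.\<close>
    have "card F = (\<Prod>i=1..CARD('n). a i)" using F(2) card by (simp add: b0)
    from extremal_lattice[OF F(1) this a _ rest, of 1] d1
    have "N = range (\<lambda>k :: nat \<Rightarrow> int. \<Sum>i=1..CARD('n). of_int (k i) *\<^sub>R (b i *\<^sub>R (v i - v 0)))" by simp
    from unimodular_equiv_model[OF N frame hull v0 a this] show ?thesis .
  qed
  {
    assume d3: "d \<le> 3"
    have model: "(\<lambda>x. x - (\<Sum>i=1..d. e i)) ` (convex hull (insert 0 ((\<lambda>i. real (d + 1) *\<^sub>R e i) ` {1..d}))) =
        model_simplex e (\<lambda>_. d + 1)"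
      by (simp add: model_simplex_def d)
    have "real ?m \<le> real ((d + 1) ^ (d - 1))" using W(1) d3 d by simp
    then show "?m \<le> (d + 1) ^ (d - 1)" by (simp only: of_nat_le_iff)
    show "?m = (d + 1) ^ (d - 1) \<longleftrightarrow> unimodular_equiv N P
        ((\<lambda>x. x - (\<Sum>i=1..d. e i)) ` (convex hull (insert 0 ((\<lambda>i. real (d + 1) *\<^sub>R e i) ` {1..d}))))"
      unfolding model
    proof
      assume eq: "?m = (d + 1) ^ (d - 1)"
      then have b: "b i = 1 / real (d + 1)" if "i \<le> d" for i
        using W(2)[of i] d3 d that by simp
      show "unimodular_equiv N P (model_simplex e (\<lambda>_. d + 1))"
      proof (rule equiv)
        have "(d + 1) ^ (d - 1) * (d + 1) = (d + 1) ^ d"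
          using d1 d by (metis Suc_pred' le_eq_less_or_eq less_one not_less_eq_eq power_Suc2 zero_less_card_finite)
        then show "?m * (d + 1) = (\<Prod>i=1..CARD('n). d + 1)" using eq d by simp
      qed (use b d eq in auto)
    next
      assume "unimodular_equiv N P (model_simplex e (\<lambda>_. d + 1))"
      from simplex_mult_model[OF N P this] show "?m = (d + 1) ^ (d - 1)"
        by (simp add: d)
    qed
  }
  {
    assume d4: "d = 4"
    define a :: "nat \<Rightarrow> nat" where "a i = (if i = 1 then 2 else 8)" for i
    have I: "{1..CARD('n)} = {1, 2, 3, 4}" using d4 d by auto
    have model: "(\<lambda>x. x - (e 1 + e 2 + e 3 + e 4)) ` (convex hull {0, 2 *\<^sub>R e 1, 8 *\<^sub>R e 2, 8 *\<^sub>R e 3, 8 *\<^sub>R e 4}) =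
        model_simplex e a"
      unfolding model_simplex_def I by (simp add: a_def add.assoc)
    have "real ?m \<le> 128" using W(3) d4 d by simp
    then show "?m \<le> 128" by linarith
    show "?m = 128 \<longleftrightarrow> unimodular_equiv N P
        ((\<lambda>x. x - (e 1 + e 2 + e 3 + e 4)) ` (convex hull {0, 2 *\<^sub>R e 1, 8 *\<^sub>R e 2, 8 *\<^sub>R e 3, 8 *\<^sub>R e 4}))"
      unfolding model
    proof
      assume eq: "?m = 128"
      then have b: "b i = (if i = 1 then 1 / 2 else 1 / 8)" if "i \<le> 4" for i
        using W(4)[of i] d4 d that by simp
      show "unimodular_equiv N P (model_simplex e a)"
      proof (rule equiv)
        \<comment> \<open>Both sides are 1024: \<open>128 * 8\<close> and
          \<open>2 * 8 * 8 * 8\<close>.\<close>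
        show "?m * 8 = (\<Prod>i=1..CARD('n). a i)" unfolding I eq by (simp add: a_def)
      qed (use b d d4 eq in \<open>auto simp: a_def\<close>)
    next
      assume equiv: "unimodular_equiv N P (model_simplex e a)"
      have "(\<Sum>i=1..CARD('n). 1 / real (a i)) < 1" unfolding I by (simp add: a_def)
      \<comment> \<open>The entry 2 stands first, so that the last entry 8 is divisible by all the
        others.\<close>
      moreover have "0 < a i \<and> a i dvd a CARD('n)" for i using d4 d by (simp add: a_def)
      ultimately have "?m = (\<Prod>i=1..<CARD('n). a i)" by (intro simplex_mult_model[OF N P equiv])
      also have "{1..<CARD('n)} = {1, 2, 3}" using d4 d by auto
      finally show "?m = 128" by (simp add: a_def)
    qed
  }
qed

end
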